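(* Let $d\in\{1,2,\dots\}$, $I=(0,1)$, and $\alpha=\frac{2d}{d+2}$. Equip $I^d$ with Lebesgue measure and the Euclidean distance. (1) There exists an orthonormal basis $(u_k)$ of $L^2_0(I^d)$ such that $$\sum_k\|u_k\|_{KR}^{\alpha+\epsilon}<\infty\quad\text{for all }\epsilon>0 .$$ (2) For every frame $(u_k)$ in $L^2_0(I^d)$ (in particular, for every Riesz basis), $$\sum_k\|u_k\|_{KR}^{\alpha}=\infty .$$
   Context: All functions are real valued. $L^2_0(I^d)=\{f\in L^2_{\mathbb R}(I^d,dx):\int_{I^d}f\,dx=0\}$, with inner product $(f,g)=\int fg\,dx$. A sequence $(u_k)$ in $L^2_0(I^d)$ is a frame if there are constants $0<b\le B<\infty$ with $b\|f\|_2^2\le\sum_k|(f,u_k)|^2\le B\|f\|_2^2$ for all $f\in L^2_0(I^d)$. A Riesz basis is the image of an orthonormal basis under a (bounded, boundedly invertible) linear isomorphism. For $u\in L^2_0(I^d)$ the Kantorovich--Rubinstein norm is $$\|u\|_{KR}=\sup\Big\{\int_{I^d}uf\,dx:\ f:I^d\to\mathbb R,\ |f(x)-f(y)|\le|x-y|\ \text{for all }x,y\in I^d\Big\},$$ where $|\cdot|$ is the Euclidean norm (equivalently, the optimal cost, for the cost function $|x-y|$, of transporting $u^+dx$ to $u^-dx$). *)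

theory Defs
  imports "HOL-Analysis.Analysis"
begin

definition open_cube :: "(real ^ 'n::finite) set" where
  "open_cube = {x. \<forall>i. 0 < x $ i \<and> x $ i < 1}"

abbreviation cube_measure :: "(real ^ 'n::finite) measure" where
  "cube_measure \<equiv> lebesgue_on open_cube"

text \<open>
  Elements of \<open>L\<^sup>2\<^sub>0\<close> are represented by functions rather than by classes of functions
  modulo null sets. Everything below depends only on the values almost everywhere on the cube,
  and equality in \<open>L\<^sup>2\<^sub>0\<close> is rendered as equality almost everywhere.
  The integral of \<open>f\<close> is meaningful because a square-integrable function on a space
  of finite measure is integrable.
\<close>

definition L20 :: "(real ^ 'n::finite \<Rightarrow> real) set" where
  "L20 = {f. f \<in> borel_measurable cube_measure \<and>
             integrable cube_measure (\<lambda>x. (f x)\<^sup>2) \<and>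
             (\<integral>x. f x \<partial>cube_measure) = 0}"

definition l2_inner :: "(real ^ 'n::finite \<Rightarrow> real) \<Rightarrow> (real ^ 'n \<Rightarrow> real) \<Rightarrow> real" where
  "l2_inner f g = (\<integral>x. f x * g x \<partial>cube_measure)"

definition l2_norm :: "(real ^ 'n::finite \<Rightarrow> real) \<Rightarrow> real" where
  "l2_norm f = sqrt (l2_inner f f)"

definition l2_frame :: "(nat \<Rightarrow> real ^ 'n::finite \<Rightarrow> real) \<Rightarrow> bool" where
  "l2_frame u \<longleftrightarrow> (\<forall>k. u k \<in> L20) \<and>
     (\<exists>b B. 0 < b \<and> b \<le> B \<and>
       (\<forall>f\<in>L20.
          ennreal (b * (l2_norm f)\<^sup>2) \<le> (\<Sum>k. ennreal (\<bar>l2_inner f (u k)\<bar>\<^sup>2)) \<and>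
          (\<Sum>k. ennreal (\<bar>l2_inner f (u k)\<bar>\<^sup>2)) \<le> ennreal (B * (l2_norm f)\<^sup>2)))"

text \<open>An orthonormal sequence whose linear span is dense in \<open>L\<^sup>2\<^sub>0\<close>.\<close>

definition l2_orthonormal_basis :: "(nat \<Rightarrow> real ^ 'n::finite \<Rightarrow> real) \<Rightarrow> bool" where
  "l2_orthonormal_basis u \<longleftrightarrow> (\<forall>k. u k \<in> L20) \<and>
     (\<forall>j k. l2_inner (u j) (u k) = (if j = k then 1 else 0)) \<and>
     (\<forall>f\<in>L20. \<forall>e>0. \<exists>N c. l2_norm (\<lambda>x. f x - (\<Sum>k<N. c k * u k x)) < e)"

text \<open>
  Linearity is required up to null sets. Together with boundedness it makes \<open>T\<close> respect
  equality almost everywhere, so that \<open>T\<close> induces a bounded linear operator on classes.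
\<close>

definition l2_bounded_linear ::
    "((real ^ 'n::finite \<Rightarrow> real) \<Rightarrow> (real ^ 'n \<Rightarrow> real)) \<Rightarrow> bool" where
  "l2_bounded_linear T \<longleftrightarrow> (\<forall>f\<in>L20. T f \<in> L20) \<and>
     (\<forall>f\<in>L20. \<forall>g\<in>L20. \<forall>a b.
        AE x in cube_measure. T (\<lambda>y. a * f y + b * g y) x = a * T f x + b * T g x) \<and>
     (\<exists>C. \<forall>f\<in>L20. l2_norm (T f) \<le> C * l2_norm f)"

definition l2_isomorphism ::
    "((real ^ 'n::finite \<Rightarrow> real) \<Rightarrow> (real ^ 'n \<Rightarrow> real)) \<Rightarrow> bool" where
  "l2_isomorphism T \<longleftrightarrow> l2_bounded_linear T \<and>
     (\<exists>S. l2_bounded_linear S \<and>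
       (\<forall>f\<in>L20. (AE x in cube_measure. S (T f) x = f x) \<and>
                (AE x in cube_measure. T (S f) x = f x)))"

definition l2_riesz_basis :: "(nat \<Rightarrow> real ^ 'n::finite \<Rightarrow> real) \<Rightarrow> bool" where
  "l2_riesz_basis u \<longleftrightarrow> (\<forall>k. u k \<in> L20) \<and>
     (\<exists>e T. l2_orthonormal_basis e \<and> l2_isomorphism T \<and>
       (\<forall>k. AE x in cube_measure. u k x = T (e k) x))"

text \<open>
  For \<open>u \<in> L\<^sup>2\<^sub>0\<close> the supremum is over a nonempty set bounded above: since \<open>u\<close> has mean
  zero, a constant can be subtracted from \<open>f\<close>, and \<open>f\<close> oscillates by at most the
  diameter of the cube.
\<close>

definition KR_norm :: "(real ^ 'n::finite \<Rightarrow> real) \<Rightarrow> real" where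
  "KR_norm u = (SUP f \<in> {f :: real ^ 'n \<Rightarrow> real. 1-lipschitz_on open_cube f}.
                  \<integral>x. u x * f x \<partial>cube_measure)"

end

theory Submission
  imports Defs
begin

text \<open>
  Let \<open>d\<close> be the dimension. Both halves rest on the same scaling: a function of \<open>L\<^sup>2\<close> norm one that
  oscillates at scale \<open>1/N\<close> inside a box of side \<open>1/N\<close> has Kantorovich--Rubinstein norm of order
  \<open>N powr (- (1 + d/2))\<close>, there is room for \<open>N ^ d\<close> of them side by side, and
  \<open>N ^ d * N powr (- (1 + d/2) * p)\<close> balances exactly at \<open>p = \<alpha> = 2 d / (d + 2)\<close>.

  Convergence above \<open>\<alpha>\<close> is realised by a Haar system. The cube is halved again and again, the direction of the
  cut running cyclically through the coordinates; a box of level \<open>n\<close> has volume \<open>2 powr (- n)\<close> and diameter of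
  order \<open>2 powr (- n/d)\<close>, and its Haar function takes opposite constant values on its two halves. Mass has to be
  moved within one box only, so \<open>KR_norm_haar_le\<close> bounds the norm by the diameter of the box times the
  \<open>L\<^sup>1\<close> norm, which for the \<open>k\<close>-th function is of order \<open>k powr (- (1/d + 1/2)) = k powr (- 1/\<alpha>)\<close>.
  Orthonormality follows from the tree structure, and density of the span (\<open>haar_complete\<close>) from the
  approximation of square integrable functions by bounded, then by continuous, then by dyadic step functions.

  For divergence at \<open>\<alpha>\<close> the sequence is tested against \<open>N ^ d\<close> translates \<open>f\<^sub>m\<close> of one small odd bump, with disjoint
  supports, height at most one and Lipschitz constant of order \<open>N\<close>. The lower frame bound, summed over \<open>m\<close>,
  bounds \<open>\<Sum>k. S\<^sub>k\<close> with \<open>S\<^sub>k = (\<Sum>m. (f\<^sub>m, u\<^sub>k)\<^sup>2)\<close> below by a constant that does not depend on \<open>N\<close>. On the other hand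
  \<open>S\<^sub>k\<close> is at most of order \<open>N powr (- d)\<close>, by Bessel's inequality (\<open>Bessel_orthogonal\<close>), and at most of order
  \<open>N\<^sup>2 * (KR_norm u\<^sub>k)\<^sup>2\<close>, because a signed sum of the bumps is still Lipschitz with a constant of order \<open>N\<close>
  (\<open>sum_inner_square_le_KR_norm\<close>). A geometric mean of the two bounds is free of \<open>N\<close> and reads
  \<open>S\<^sub>k \<le> C * KR_norm u\<^sub>k powr \<alpha>\<close>. If the right-hand sides were summable, dominated convergence would give
  \<open>\<Sum>k. S\<^sub>k \<longlonglongrightarrow> 0\<close> as \<open>N\<close> grows, a contradiction (\<open>KR_norm_powr_diverges\<close>). The argument uses the lower frame
  bound and a bound on the norms of the \<open>u\<^sub>k\<close>, and both also hold for a Riesz basis.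
\<close>

section \<open>Square integrable functions on the cube\<close>

lemma open_cube_eq_box: "(open_cube :: (real ^ 'n::finite) set) = box 0 1"
  by (auto simp: open_cube_def mem_box_cart)

lemma open_cube_lmeasurable [simp]: "(open_cube :: (real ^ 'n::finite) set) \<in> lmeasurable"
  by (simp add: open_cube_eq_box)

lemma measure_open_cube [simp]: "measure lebesgue (open_cube :: (real ^ 'n::finite) set) = 1"
proof -
  have "cbox 0 (1 :: real ^ 'n) \<noteq> {}"
    by (auto simp: interval_eq_empty_cart)
  then have "measure lebesgue (cbox 0 (1 :: real ^ 'n)) = 1"
    by (simp add: content_cbox_cart)
  then show ?thesis
    by (simp add: open_cube_eq_box measure_lborel_box_eq measure_lborel_cbox_eq)
qed

lemma open_cube_sets [measurable, simp]: "(open_cube :: (real ^ 'n::finite) set) \<in> sets lebesgue"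
  by (rule fmeasurableD) simp

lemma cube_measure_finite: "finite_measure (cube_measure :: (real ^ 'n::finite) measure)"
  by (rule finite_measure_lebesgue_on) simp

lemma integral_cube_const [simp]: "(\<integral>x. c \<partial>(cube_measure :: (real ^ 'n::finite) measure)) = (c::real)"
  by (simp add: measure_restrict_space)

lemma dist_open_cube_le:
  fixes x y :: "real ^ 'n::finite"
  assumes "x \<in> open_cube" "y \<in> open_cube"
  shows "dist x y \<le> real CARD('n)"
proof -
  have "dist x y \<le> (\<Sum>i\<in>UNIV. \<bar>(x - y) $ i\<bar>)"
    unfolding dist_norm by (rule norm_le_l1_cart)
  also have "\<dots> \<le> (\<Sum>i\<in>(UNIV::'n set). 1)"
  proof (rule sum_mono)
    fix i :: 'n
    have "0 < x $ i" "x $ i < 1" "0 < y $ i" "y $ i < 1"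
      using assms by (auto simp: open_cube_def)
    then show "\<bar>(x - y) $ i\<bar> \<le> 1"
      by simp
  qed
  finally show ?thesis by simp
qed

lemma integral_indicator_cube:
  assumes "A \<in> sets lebesgue" "A \<subseteq> (open_cube :: (real ^ 'n::finite) set)"
  shows "(\<integral>x. indicat_real A x \<partial>cube_measure) = measure lebesgue A"
    and "integrable cube_measure (indicat_real A)"
proof -
  interpret finite_measure "cube_measure :: (real ^ 'n) measure"
    by (rule cube_measure_finite)
  have "A \<in> sets cube_measure"
    using assms by (simp add: sets_restrict_space_iff)
  then show "integrable cube_measure (indicat_real A)"
    by (auto simp: integrable_indicator_iff emeasure_eq_measure intro: sets.Int)
  show "(\<integral>x. indicat_real A x \<partial>cube_measure) = measure lebesgue A"
    using assms \<open>A \<in> sets cube_measure\<close>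
    by (simp add: measure_restrict_space Int_absorb2)
qed

definition square_int :: "(real ^ 'n::finite \<Rightarrow> real) \<Rightarrow> bool" where
  "square_int f \<longleftrightarrow> f \<in> borel_measurable cube_measure \<and> integrable cube_measure (\<lambda>x. (f x)\<^sup>2)"

lemma L20_iff: "f \<in> L20 \<longleftrightarrow> square_int f \<and> (\<integral>x. f x \<partial>cube_measure) = 0"
  by (auto simp: L20_def square_int_def)

lemma L20_square_int: "f \<in> L20 \<Longrightarrow> square_int f"
  by (simp add: L20_iff)

lemma square_int_measurable: "square_int f \<Longrightarrow> f \<in> borel_measurable cube_measure"
  by (simp add: square_int_def)

lemma integrable_mult_square_int:
  assumes "square_int f" "square_int g"
  shows "integrable cube_measure (\<lambda>x. f x * g x)"
proof (rule Bochner_Integration.integrable_bound)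
  show "integrable cube_measure (\<lambda>x. (f x)\<^sup>2 + (g x)\<^sup>2)"
    using assms by (auto simp: square_int_def)
  show "(\<lambda>x. f x * g x) \<in> borel_measurable cube_measure"
    using assms by (auto simp: square_int_def)
  have "\<bar>a * b\<bar> \<le> a\<^sup>2 + b\<^sup>2" for a b :: real
    using sum_squares_bound[of "\<bar>a\<bar>" "\<bar>b\<bar>"] mult_nonneg_nonneg[of "\<bar>a\<bar>" "\<bar>b\<bar>"]
    by (simp only: abs_mult power2_abs) linarith
  then show "AE x in cube_measure. norm (f x * g x) \<le> norm ((f x)\<^sup>2 + (g x)\<^sup>2)"
    by auto
qed

lemma square_int_bounded:
  assumes "f \<in> borel_measurable (cube_measure :: (real ^ 'n::finite) measure)"
    and "\<And>x. x \<in> open_cube \<Longrightarrow> \<bar>f x\<bar> \<le> K"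
  shows "square_int f"
proof -
  interpret finite_measure "cube_measure :: (real ^ 'n::finite) measure"
    by (rule cube_measure_finite)
  have "(f x)\<^sup>2 \<le> K\<^sup>2" if "x \<in> open_cube" for x
    using assms(2)[OF that] by (metis abs_ge_zero power2_abs power_mono)
  then have "integrable cube_measure (\<lambda>x. (f x)\<^sup>2)"
    using assms(1) by (intro integrable_const_bound[where B = "K\<^sup>2"] AE_I2) auto
  with assms(1) show ?thesis by (simp add: square_int_def)
qed

lemma square_int_const: "square_int (\<lambda>x. c)"
  by (rule square_int_bounded[where K = "\<bar>c\<bar>"]) auto

lemma integrable_square_int: "square_int f \<Longrightarrow> integrable cube_measure f"
  using integrable_mult_square_int[OF _ square_int_const[of 1]] by simp

lemma square_int_cmult: "square_int f \<Longrightarrow> square_int (\<lambda>x. c * f x)"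
  by (auto simp: square_int_def power_mult_distrib)

lemma square_int_add:
  assumes "square_int f" "square_int g"
  shows "square_int (\<lambda>x. f x + g x)"
  using assms integrable_mult_square_int[OF assms]
  by (auto simp: square_int_def power2_sum mult.assoc)

lemma square_int_diff:
  assumes "square_int f" "square_int g"
  shows "square_int (\<lambda>x. f x - g x)"
  using square_int_add[OF assms(1) square_int_cmult[OF assms(2), of "-1"]] by simp

lemma square_int_sum:
  "(\<And>i. i \<in> S \<Longrightarrow> square_int (f i)) \<Longrightarrow> square_int (\<lambda>x. \<Sum>i\<in>S. f i x)"
  by (induction S rule: infinite_finite_induct) (auto intro: square_int_add square_int_const)

lemma L20_cmult: "f \<in> L20 \<Longrightarrow> (\<lambda>x. c * f x) \<in> L20"
  by (simp add: L20_iff square_int_cmult)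

lemma L20_add: "f \<in> L20 \<Longrightarrow> g \<in> L20 \<Longrightarrow> (\<lambda>x. f x + g x) \<in> L20"
  by (simp add: L20_iff square_int_add integrable_square_int)

lemma L20_diff: "f \<in> L20 \<Longrightarrow> g \<in> L20 \<Longrightarrow> (\<lambda>x. f x - g x) \<in> L20"
  by (simp add: L20_iff square_int_diff integrable_square_int)

lemma L20_sum: "(\<And>i. i \<in> S \<Longrightarrow> f i \<in> L20) \<Longrightarrow> (\<lambda>x. \<Sum>i\<in>S. f i x) \<in> L20"
proof (induction S rule: infinite_finite_induct)
  case (insert i S)
  then show ?case by (simp add: L20_add)
qed (simp_all add: L20_iff square_int_const)

lemma l2_inner_commute: "l2_inner f g = l2_inner g f"
  by (simp add: l2_inner_def mult.commute)

lemma l2_inner_self_nonneg: "0 \<le> l2_inner f f"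
  by (simp add: l2_inner_def)

lemma l2_norm_nonneg: "0 \<le> l2_norm f"
  by (simp add: l2_norm_def l2_inner_self_nonneg)

lemma l2_norm_square: "(l2_norm f)\<^sup>2 = l2_inner f f"
  by (simp add: l2_norm_def l2_inner_self_nonneg)

lemma l2_inner_cmult_left: "l2_inner (\<lambda>x. c * f x) g = c * l2_inner f g"
  by (simp add: l2_inner_def mult.assoc)

lemma l2_inner_cmult_right: "l2_inner f (\<lambda>x. c * g x) = c * l2_inner f g"
  by (simp add: l2_inner_def mult.left_commute)

lemma l2_inner_add_left:
  assumes "square_int f" "square_int g" "square_int h"
  shows "l2_inner (\<lambda>x. f x + g x) h = l2_inner f h + l2_inner g h"
  using assms by (simp add: l2_inner_def distrib_right integrable_mult_square_int)

lemma l2_inner_sum_left: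
  assumes "\<And>i. i \<in> S \<Longrightarrow> square_int (f i)" "square_int g"
  shows "l2_inner (\<lambda>x. \<Sum>i\<in>S. c i * f i x) g = (\<Sum>i\<in>S. c i * l2_inner (f i) g)"
proof -
  have "l2_inner (\<lambda>x. \<Sum>i\<in>S. c i * f i x) g = (\<integral>x. (\<Sum>i\<in>S. c i * (f i x * g x)) \<partial>cube_measure)"
    by (simp add: l2_inner_def sum_distrib_right mult.assoc)
  also have "\<dots> = (\<Sum>i\<in>S. \<integral>x. c i * (f i x * g x) \<partial>cube_measure)"
    using assms by (intro Bochner_Integration.integral_sum) (auto intro: integrable_mult_square_int)
  finally show ?thesis
    by (simp add: l2_inner_def)
qed

lemma l2_inner_sum_right:
  assumes "\<And>i. i \<in> S \<Longrightarrow> square_int (f i)" "square_int g"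
  shows "l2_inner g (\<lambda>x. \<Sum>i\<in>S. c i * f i x) = (\<Sum>i\<in>S. c i * l2_inner g (f i))"
  using l2_inner_sum_left[where f = f and S = S and c = c, OF assms]
  by (simp add: l2_inner_commute[of g])

lemma l2_inner_diff_self:
  assumes "square_int f" "square_int g"
  shows "l2_inner (\<lambda>x. f x - g x) (\<lambda>x. f x - g x) = l2_inner f f - 2 * l2_inner f g + l2_inner g g"
proof -
  have "l2_inner (\<lambda>x. f x - g x) (\<lambda>x. f x - g x)
      = (\<integral>x. f x * f x - 2 * (f x * g x) + g x * g x \<partial>cube_measure)"
    unfolding l2_inner_def by (rule arg_cong[where f = "lebesgue_integral _"]) (auto simp: algebra_simps)
  then show ?thesis
    using assms by (simp add: l2_inner_def integrable_mult_square_int)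
qed

lemma l2_inner_cong_AE:
  assumes "AE x in cube_measure. f x = f' x" "AE x in cube_measure. g x = g' x"
    and "square_int f" "square_int f'" "square_int g" "square_int g'"
  shows "l2_inner f g = l2_inner f' g'"
  unfolding l2_inner_def
proof (rule integral_cong_AE)
  show "AE x in cube_measure. f x * g x = f' x * g' x"
    using assms(1,2) by eventually_elim simp
qed (use assms in \<open>auto simp: square_int_def\<close>)

lemma l2_Cauchy_Schwarz:
  assumes "square_int f" "square_int g"
  shows "\<bar>l2_inner f g\<bar> \<le> l2_norm f * l2_norm g"
proof -
  have *: "0 \<le> l2_inner f f - 2 * t * l2_inner f g + t\<^sup>2 * l2_inner g g" for t
  proof -
    have "0 \<le> l2_inner (\<lambda>x. f x - t * g x) (\<lambda>x. f x - t * g x)"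
      by (rule l2_inner_self_nonneg)
    also have "\<dots> = l2_inner f f - 2 * l2_inner f (\<lambda>x. t * g x) + l2_inner (\<lambda>x. t * g x) (\<lambda>x. t * g x)"
      using assms by (intro l2_inner_diff_self square_int_cmult)
    also have "l2_inner f (\<lambda>x. t * g x) = t * l2_inner f g"
      by (rule l2_inner_cmult_right)
    also have "l2_inner (\<lambda>x. t * g x) (\<lambda>x. t * g x) = t\<^sup>2 * l2_inner g g"
      by (simp add: l2_inner_cmult_left l2_inner_cmult_right power2_eq_square)
    finally show ?thesis by simp
  qed
  have "(l2_inner f g)\<^sup>2 \<le> l2_inner f f * l2_inner g g"
  proof (cases "l2_inner g g = 0")
    case True
    have "l2_inner f g = 0"
    proof (rule ccontr)
      assume "l2_inner f g \<noteq> 0"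
      with *[of "(l2_inner f f + 1) / (2 * l2_inner f g)"] True show False
        by (simp add: field_simps)
    qed
    with True show ?thesis by simp
  next
    case False
    then have "0 < l2_inner g g"
      using l2_inner_self_nonneg[of g] by simp
    with *[of "l2_inner f g / l2_inner g g"] show ?thesis
      by (simp add: field_simps power2_eq_square)
  qed
  then have "(l2_inner f g)\<^sup>2 \<le> (l2_norm f * l2_norm g)\<^sup>2"
    by (simp add: power_mult_distrib l2_norm_square)
  then show ?thesis
    using power2_le_iff_abs_le[of "l2_norm f * l2_norm g" "l2_inner f g"] by (simp add: l2_norm_nonneg)
qed

lemma l2_norm_triangle:
  assumes "square_int f" "square_int g"
  shows "l2_norm (\<lambda>x. f x + g x) \<le> l2_norm f + l2_norm g"
proof (rule power2_le_imp_le)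
  have "(l2_norm (\<lambda>x. f x + g x))\<^sup>2
      = (\<integral>x. f x * f x + 2 * (f x * g x) + g x * g x \<partial>cube_measure)"
    unfolding l2_norm_square l2_inner_def
    by (rule arg_cong[where f = "lebesgue_integral _"]) (auto simp: algebra_simps)
  then have "(l2_norm (\<lambda>x. f x + g x))\<^sup>2 = l2_inner f f + 2 * l2_inner f g + l2_inner g g"
    using assms by (simp add: l2_inner_def integrable_mult_square_int)
  then show "(l2_norm (\<lambda>x. f x + g x))\<^sup>2 \<le> (l2_norm f + l2_norm g)\<^sup>2"
    using l2_Cauchy_Schwarz[OF assms] by (simp add: power2_sum l2_norm_square)
qed (simp add: l2_norm_nonneg)

section \<open>The Kantorovich--Rubinstein norm\<close>

lemma lipschitz_bounded_on_cube:
  fixes f :: "real ^ 'n::finite \<Rightarrow> real"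
  assumes "L-lipschitz_on open_cube f" 
  obtains K where "\<And>x. x \<in> open_cube \<Longrightarrow> \<bar>f x\<bar> \<le> K"
proof -
  let ?z = "\<chi> i. 1/2 :: real ^ 'n"
  have z: "?z \<in> open_cube" by (simp add: open_cube_def)
  have "0 \<le> L" using assms by (rule lipschitz_on_nonneg)
  have "\<bar>f x\<bar> \<le> \<bar>f ?z\<bar> + L * real CARD('n)" if "x \<in> open_cube" for x
  proof -
    have "dist (f x) (f ?z) \<le> L * dist x ?z"
      using assms that z by (rule lipschitz_onD)
    also have "\<dots> \<le> L * real CARD('n)"
      using dist_open_cube_le[OF that z] \<open>0 \<le> L\<close> by (rule mult_left_mono)
    finally show ?thesis by (simp add: dist_real_def)
  qed
  then show thesis by (rule that)
qed

lemma lipschitz_square_int: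
  fixes f :: "real ^ 'n::finite \<Rightarrow> real"
  assumes "L-lipschitz_on open_cube f"
  shows "square_int f"
proof -
  obtain K where "\<And>x. x \<in> open_cube \<Longrightarrow> \<bar>f x\<bar> \<le> K"
    using lipschitz_bounded_on_cube[OF assms] by blast
  moreover have "f \<in> borel_measurable cube_measure"
    using continuous_imp_measurable_on_sets_lebesgue[OF lipschitz_on_continuous_on[OF assms]] by simp
  ultimately show ?thesis by (intro square_int_bounded)
qed

text \<open>
  Pairing a mean zero function with a Lipschitz function only sees the oscillation of the latter on
  the support of the former, because a constant can be subtracted.
\<close>

lemma lipschitz_pairing_le:
  fixes u f :: "real ^ 'n::finite \<Rightarrow> real"
  assumes u: "u \<in> L20" and f: "1-lipschitz_on open_cube f"
    and diam: "\<And>x y. x \<in> open_cube \<Longrightarrow> y \<in> open_cube \<Longrightarrow> u x \<noteq> 0 \<Longrightarrow> u y \<noteq> 0 \<Longrightarrow> dist x y \<le> \<delta>"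
  shows "(\<integral>x. u x * f x \<partial>cube_measure) \<le> \<delta> * (\<integral>x. \<bar>u x\<bar> \<partial>cube_measure)"
proof (cases "\<exists>z\<in>open_cube. u z \<noteq> 0")
  case True
  then obtain z where z: "z \<in> open_cube" "u z \<noteq> 0" by blast
  have fs: "square_int f" using f by (rule lipschitz_square_int)
  have us: "square_int u" and u0: "(\<integral>x. u x \<partial>cube_measure) = 0"
    using u by (auto simp: L20_iff)
  have "(\<integral>x. u x * f x \<partial>cube_measure) = (\<integral>x. u x * f x - f z * u x \<partial>cube_measure)"
    using u0 us fs by (simp add: integrable_mult_square_int integrable_square_int)
  also have "\<dots> \<le> (\<integral>x. \<delta> * \<bar>u x\<bar> \<partial>cube_measure)"
  proof (rule integral_mono)
    fix x assume "x \<in> space (cube_measure :: (real ^ 'n) measure)"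
    then have x: "x \<in> open_cube" by simp
    show "u x * f x - f z * u x \<le> \<delta> * \<bar>u x\<bar>"
    proof (cases "u x = 0")
      case False
      have "\<bar>f x - f z\<bar> \<le> dist x z"
        using lipschitz_onD[OF f x z(1)] by (simp add: dist_real_def)
      also have "\<dots> \<le> \<delta>" using diam[OF x z(1) False z(2)] .
      finally have "\<bar>u x\<bar> * \<bar>f x - f z\<bar> \<le> \<bar>u x\<bar> * \<delta>"
        by (intro mult_left_mono) auto
      moreover have "u x * f x - f z * u x \<le> \<bar>u x\<bar> * \<bar>f x - f z\<bar>"
        using abs_ge_self[of "u x * (f x - f z)"]
        by (simp only: abs_mult[symmetric] right_diff_distrib mult.commute[of "f z"])
      ultimately show ?thesis by (simp add: mult.commute)
    qed simp
  qed (use us fs in \<open>auto simp: integrable_mult_square_int integrable_square_int\<close>)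
  finally show ?thesis by simp
next
  case False
  then have "(\<integral>x. u x * f x \<partial>cube_measure) = (\<integral>x. 0 \<partial>(cube_measure :: (real ^ 'n) measure))"
    by (intro Bochner_Integration.integral_cong) auto
  moreover have "(\<integral>x. \<bar>u x\<bar> \<partial>cube_measure) = (\<integral>x. 0 \<partial>(cube_measure :: (real ^ 'n) measure))"
    using False by (intro Bochner_Integration.integral_cong) auto
  ultimately show ?thesis by simp
qed

text \<open>
  Functions concentrated on a small set have small norm. In the opposite direction
  \<open>lipschitz_pairing_le_KR_norm\<close> bounds the norm below by Lipschitz test functions; there the supremum must be
  finite, which holds because the cube is bounded.
\<close>

lemma KR_norm_le:
  fixes u :: "real ^ 'n::finite \<Rightarrow> real"
  assumes "u \<in> L20"
    and "\<And>x y. x \<in> open_cube \<Longrightarrow> y \<in> open_cube \<Longrightarrow> u x \<noteq> 0 \<Longrightarrow> u y \<noteq> 0 \<Longrightarrow> dist x y \<le> \<delta>"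
  shows "KR_norm u \<le> \<delta> * (\<integral>x. \<bar>u x\<bar> \<partial>cube_measure)"
  unfolding KR_norm_def
proof (rule cSUP_least)
  have "1-lipschitz_on open_cube (\<lambda>x::real^'n. 0::real)"
    by (rule lipschitz_on_le[OF lipschitz_on_constant]) simp
  then show "{f :: real ^ 'n \<Rightarrow> real. 1-lipschitz_on open_cube f} \<noteq> {}" by blast
qed (use lipschitz_pairing_le[OF assms(1) _ assms(2)] in auto)

lemma lipschitz_pairing_le_KR_norm_1:
  fixes u :: "real ^ 'n::finite \<Rightarrow> real"
  assumes "u \<in> L20" "1-lipschitz_on open_cube f"
  shows "(\<integral>x. u x * f x \<partial>cube_measure) \<le> KR_norm u"
  unfolding KR_norm_def
proof (rule cSUP_upper)
  show "bdd_above ((\<lambda>f. \<integral>x. u x * f x \<partial>cube_measure) ` {f. 1-lipschitz_on open_cube f})"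
    using lipschitz_pairing_le[OF assms(1) _ dist_open_cube_le] by (intro bdd_aboveI2) auto
qed (use assms in auto)

lemma KR_norm_nonneg:
  fixes u :: "real ^ 'n::finite \<Rightarrow> real"
  assumes "u \<in> L20"
  shows "0 \<le> KR_norm u"
proof -
  have "1-lipschitz_on open_cube (\<lambda>x::real^'n. 0::real)"
    by (rule lipschitz_on_le[OF lipschitz_on_constant]) simp
  from lipschitz_pairing_le_KR_norm_1[OF assms this] show ?thesis by simp
qed

lemma lipschitz_pairing_le_KR_norm:
  fixes u :: "real ^ 'n::finite \<Rightarrow> real"
  assumes u: "u \<in> L20" and f: "L-lipschitz_on open_cube f" and L: "0 < L"
  shows "(\<integral>x. u x * f x \<partial>cube_measure) \<le> L * KR_norm u"
proof -
  have "(\<bar>inverse L\<bar> * L)-lipschitz_on open_cube (\<lambda>x. inverse L * f x)"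
    using f by (rule lipschitz_on_cmult_real)
  then have "1-lipschitz_on open_cube (\<lambda>x. inverse L * f x)"
    using L by simp
  from lipschitz_pairing_le_KR_norm_1[OF u this]
  have "inverse L * (\<integral>x. u x * f x \<partial>cube_measure) \<le> KR_norm u"
    by (simp add: mult.left_commute)
  then show ?thesis using L by (simp add: field_simps)
qed

section \<open>Odd bumps on a grid\<close>

definition tent :: "real ^ 'n::finite \<Rightarrow> real" where
  "tent y = max 0 (1 - norm y)"

text \<open>
  The test functions must have mean zero. Subtracting a constant from a tent would destroy the compact support,
  hence two tents of opposite sign.
\<close>

definition odd_bump :: "real ^ 'n::finite \<Rightarrow> real ^ 'n \<Rightarrow> real" where
  "odd_bump e y = tent (y - e) - tent (y + e)"

lemma odd_bump_uminus: "odd_bump e (- y) = - odd_bump e y"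
proof -
  have "- y - e = - (y + e)" "- y + e = - (y - e)"
    by (simp_all add: algebra_simps)
  then show ?thesis by (simp only: odd_bump_def tent_def norm_minus_cancel)
qed

lemma abs_odd_bump_le_1: "\<bar>odd_bump e y\<bar> \<le> 1"
  using norm_ge_zero[of "y - e"] norm_ge_zero[of "y + e"]
  unfolding odd_bump_def tent_def by linarith

lemma odd_bump_eq_0:
  assumes "norm e = 1" "2 \<le> norm y"
  shows "odd_bump e y = 0"
  using assms norm_triangle_ineq2[of y e] norm_triangle_ineq2[of y "-e"]
  by (simp add: odd_bump_def tent_def)

lemma odd_bump_ge_half:
  assumes "norm e = 1" "norm (y - e) \<le> 1/2"
  shows "1/2 \<le> odd_bump e y"
proof -
  have "norm (2 *\<^sub>R e) - norm (y - e) \<le> norm (2 *\<^sub>R e + (y - e))"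
    by (rule norm_diff_ineq)
  moreover have "2 *\<^sub>R e + (y - e) = y + e"
    by (simp add: scaleR_2)
  ultimately have "1 \<le> norm (y + e)"
    using assms by simp
  with assms show ?thesis by (simp add: odd_bump_def tent_def)
qed

lemma odd_bump_lipschitz: "\<bar>odd_bump e x - odd_bump e y\<bar> \<le> 2 * norm (x - y)"
proof -
  have "\<bar>tent a - tent b\<bar> \<le> norm (a - b)" for a b :: "real ^ 'n"
    using norm_triangle_ineq3[of a b] by (simp add: tent_def max_def abs_if split: if_splits)
  from this[of "x - e" "y - e"] this[of "x + e" "y + e"] show ?thesis
    by (simp add: odd_bump_def)
qed

definition bump_at :: "real ^ 'n::finite \<Rightarrow> real \<Rightarrow> real ^ 'n \<Rightarrow> real ^ 'n \<Rightarrow> real" where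
  "bump_at e r c x = odd_bump e (inverse r *\<^sub>R (x - c))"

lemma bump_at_eq_0:
  assumes "norm e = 1" "0 < r" "x \<notin> ball c (2 * r)"
  shows "bump_at e r c x = 0"
proof -
  have "2 \<le> norm (x - c) / r"
    using assms by (simp add: dist_norm norm_minus_commute pos_le_divide_eq)
  then have "2 \<le> norm (inverse r *\<^sub>R (x - c))"
    using assms(2) by (simp add: divide_inverse mult.commute)
  with assms(1) show ?thesis by (simp add: bump_at_def odd_bump_eq_0)
qed

lemma bump_at_lipschitz:
  assumes "0 < r"
  shows "(2 / r)-lipschitz_on S (bump_at e r c)"
proof (rule lipschitz_onI)
  fix x y
  have "\<bar>bump_at e r c x - bump_at e r c y\<bar> \<le> 2 * norm (inverse r *\<^sub>R (x - y))"
    using odd_bump_lipschitz[of e "inverse r *\<^sub>R (x - c)" "inverse r *\<^sub>R (y - c)"]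
    by (simp add: bump_at_def flip: scaleR_diff_right)
  also have "norm (inverse r *\<^sub>R (x - y)) = norm (x - y) / r"
    using assms by (simp add: divide_inverse mult.commute)
  finally show "dist (bump_at e r c x) (bump_at e r c y) \<le> 2 / r * dist x y"
    by (simp add: dist_real_def dist_norm)
qed (use assms in simp)

lemma lborel_reflect: "distr lborel borel (\<lambda>x. 2 *\<^sub>R c - x) = (lborel :: (real ^ 'n::finite) measure)"
  using lborel_affine[of "-1" "2 *\<^sub>R c"] by (simp add: density_1)

text \<open>Reflection in the centre changes the sign of a bump, so its integral over the whole space vanishes.\<close>

lemma bump_at_L20:
  fixes e c :: "real ^ 'n::finite"
  assumes e: "norm e = 1" and r: "0 < r" and sub: "ball c (2 * r) \<subseteq> open_cube"
  shows "bump_at e r c \<in> L20"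
proof -
  have lip: "(2 / r)-lipschitz_on S (bump_at e r c)" for S
    using r by (rule bump_at_lipschitz)
  have meas [measurable]: "bump_at e r c \<in> borel_measurable borel"
    using lipschitz_on_continuous_on[OF lip[of UNIV]] by (rule borel_measurable_continuous_onI)
  have odd: "bump_at e r c (2 *\<^sub>R c - x) = - bump_at e r c x" for x
  proof -
    have "inverse r *\<^sub>R (2 *\<^sub>R c - x - c) = - (inverse r *\<^sub>R (x - c))"
      by (simp add: scaleR_2 algebra_simps)
    then show ?thesis by (simp only: bump_at_def odd_bump_uminus)
  qed
  have "(\<integral>x. bump_at e r c x \<partial>lborel) = (\<integral>x. bump_at e r c x \<partial>(distr lborel borel (\<lambda>x. 2 *\<^sub>R c - x)))"
    by (simp only: lborel_reflect)
  also have "\<dots> = (\<integral>x. bump_at e r c (2 *\<^sub>R c - x) \<partial>lborel)"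
    by (rule integral_distr) measurable
  also have "\<dots> = - (\<integral>x. bump_at e r c x \<partial>lborel)"
    by (simp add: odd)
  finally have zero: "(\<integral>x. bump_at e r c x \<partial>lborel) = 0"
    by simp
  have "(\<integral>x. bump_at e r c x \<partial>cube_measure) = (\<integral>x. indicat_real open_cube x *\<^sub>R bump_at e r c x \<partial>lebesgue)"
    by (rule integral_restrict_space) simp
  also have "(\<lambda>x. indicat_real open_cube x *\<^sub>R bump_at e r c x) = bump_at e r c"
  proof
    fix x show "indicat_real open_cube x *\<^sub>R bump_at e r c x = bump_at e r c x"
    proof (cases "x \<in> open_cube")
      case False
      then have "x \<notin> ball c (2 * r)" using sub by blast
      then show ?thesis using bump_at_eq_0[OF e r] by simp
    qed simp
  qed
  also have "(\<integral>x. bump_at e r c x \<partial>lebesgue) = (\<integral>x. bump_at e r c x \<partial>lborel)"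
    by (rule integral_completion) measurable
  finally show ?thesis
    using zero lipschitz_square_int[OF lip] by (simp add: L20_iff)
qed

text \<open>
  The absolute value of a bump is at most one, vanishes outside one ball, and is at least one half on another ball,
  around the positive peak. Both radii are comparable to \<open>r\<close>.
\<close>

lemma bump_at_l2_bounds:
  fixes e c :: "real ^ 'n::finite"
  assumes e: "norm e = 1" and r: "0 < r" and sub: "ball c (2 * r) \<subseteq> open_cube"
  shows "l2_inner (bump_at e r c) (bump_at e r c) \<le> unit_ball_vol (real CARD('n)) * (2 * r) ^ CARD('n)"
    and "unit_ball_vol (real CARD('n)) * (r / 2) ^ CARD('n) / 4 \<le> l2_inner (bump_at e r c) (bump_at e r c)"
proof -
  let ?f = "bump_at e r c"
  let ?B = "ball (c + r *\<^sub>R e) (r / 2)"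
  have int: "integrable cube_measure (\<lambda>x. ?f x * ?f x)"
    using bump_at_L20[OF assms] by (simp add: L20_iff integrable_mult_square_int)
  have "?f x * ?f x \<le> indicat_real (ball c (2 * r)) x" for x
  proof (cases "x \<in> ball c (2 * r)")
    case True
    have "\<bar>?f x\<bar> * \<bar>?f x\<bar> \<le> 1 * 1"
      unfolding bump_at_def by (intro mult_mono abs_odd_bump_le_1) auto
    with True show ?thesis by simp
  next
    case False
    then show ?thesis using bump_at_eq_0[OF e r] by simp
  qed
  then have "l2_inner ?f ?f \<le> (\<integral>x. indicat_real (ball c (2 * r)) x \<partial>cube_measure)"
    unfolding l2_inner_def using int integral_indicator_cube[OF _ sub]
    by (intro integral_mono) auto
  also have "\<dots> = measure lebesgue (ball c (2 * r))"
    using sub by (intro integral_indicator_cube) auto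
  also have "\<dots> = unit_ball_vol (real CARD('n)) * (2 * r) ^ CARD('n)"
    using r by (simp add: content_ball)
  finally show "l2_inner ?f ?f \<le> unit_ball_vol (real CARD('n)) * (2 * r) ^ CARD('n)" .
  have subB: "?B \<subseteq> open_cube"
  proof -
    have "?B \<subseteq> ball c (2 * r)"
    proof
      fix x assume "x \<in> ?B"
      then have "norm (x - (c + r *\<^sub>R e)) < r / 2" by (simp add: dist_norm norm_minus_commute)
      moreover have "norm (x - c) \<le> norm (x - (c + r *\<^sub>R e)) + norm (r *\<^sub>R e)"
        using norm_triangle_ineq[of "x - (c + r *\<^sub>R e)" "r *\<^sub>R e"] by simp
      ultimately have "norm (x - c) < 2 * r"
        using e r by simp
      then show "x \<in> ball c (2 * r)" by (simp add: dist_norm norm_minus_commute)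
    qed
    with sub show ?thesis by blast
  qed
  have "indicat_real ?B x / 4 \<le> ?f x * ?f x" for x
  proof (cases "x \<in> ?B")
    case True
    have "inverse r *\<^sub>R (x - c) - e = inverse r *\<^sub>R (x - (c + r *\<^sub>R e))"
      using r by (simp add: scaleR_right_diff_distrib scaleR_right_distrib)
    then have "norm (inverse r *\<^sub>R (x - c) - e) = norm (x - (c + r *\<^sub>R e)) / r"
      using r by (simp add: divide_inverse mult.commute)
    also have "\<dots> \<le> 1/2"
      using True r by (simp add: dist_norm norm_minus_commute pos_divide_le_eq)
    finally have "norm (inverse r *\<^sub>R (x - c) - e) \<le> 1/2" .
    then have "1/2 \<le> ?f x"
      unfolding bump_at_def using e by (intro odd_bump_ge_half)
    then have "1/2 * (1/2) \<le> ?f x * ?f x"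
      by (intro mult_mono) auto
    with True show ?thesis by simp
  qed simp
  then have "(\<integral>x. indicat_real ?B x / 4 \<partial>cube_measure) \<le> l2_inner ?f ?f"
    unfolding l2_inner_def using int integral_indicator_cube[OF _ subB]
    by (intro integral_mono) auto
  moreover have "(\<integral>x. indicat_real ?B x / 4 \<partial>cube_measure) = measure lebesgue ?B / 4"
    using integral_indicator_cube[OF _ subB] by simp
  ultimately show "unit_ball_vol (real CARD('n)) * (r / 2) ^ CARD('n) / 4 \<le> l2_inner ?f ?f"
    using r by (simp add: content_ball)
qed

definition grid_centre :: "nat \<Rightarrow> ('n::finite \<Rightarrow> nat) \<Rightarrow> real ^ 'n" where
  "grid_centre N m = (\<chi> i. (real (m i) + 1/2) / real N)"

lemma grid_centre_ball_subset:
  assumes "\<And>i. m i < N"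
  shows "ball (grid_centre N m) (1 / (2 * real N)) \<subseteq> (open_cube :: (real ^ 'n::finite) set)"
proof
  fix x :: "real ^ 'n" assume x: "x \<in> ball (grid_centre N m) (1 / (2 * real N))"
  have "0 < x $ i \<and> x $ i < 1" for i
  proof -
    have N: "0 < real N" using assms[of i] by simp
    have "\<bar>(x - grid_centre N m) $ i\<bar> < 1 / (2 * real N)"
      using x component_le_norm_cart[of "x - grid_centre N m" i] by (simp add: dist_norm norm_minus_commute)
    then have "real N * \<bar>x $ i - (real (m i) + 1/2) / real N\<bar> < 1/2"
      using N by (simp add: grid_centre_def field_simps)
    moreover have "real N * \<bar>x $ i - (real (m i) + 1/2) / real N\<bar> = \<bar>real N * x $ i - (real (m i) + 1/2)\<bar>"
      using N by (simp add: abs_mult_pos' right_diff_distrib)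
    ultimately have *: "\<bar>real N * x $ i - (real (m i) + 1/2)\<bar> < 1/2" by simp
    have "real (m i) + 1 \<le> real N" using assms[of i] by linarith
    with * have "0 < real N * x $ i" "real N * x $ i < real N * 1" by linarith+
    with N show ?thesis by (simp add: zero_less_mult_iff)
  qed
  then show "x \<in> open_cube" by (simp add: open_cube_def)
qed

lemma grid_centre_separated:
  assumes "m \<noteq> m'" "0 < N"
  shows "1 / real N \<le> dist (grid_centre N m) (grid_centre N m')"
proof -
  obtain i where i: "m i \<noteq> m' i" using assms(1) by blast
  have "1 \<le> \<bar>real (m i) - real (m' i)\<bar>" using i by linarith
  then have "1 / real N \<le> \<bar>real (m i) - real (m' i)\<bar> / real N"
    using assms(2) by (simp add: divide_right_mono)
  also have "\<dots> = \<bar>(grid_centre N m - grid_centre N m') $ i\<bar>"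
    using assms(2) by (simp add: grid_centre_def diff_divide_distrib[symmetric])
  also have "\<dots> \<le> norm (grid_centre N m - grid_centre N m')"
    by (rule component_le_norm_cart)
  finally show ?thesis by (simp add: dist_norm)
qed

text \<open>
  A bump of scale \<open>r\<close> lives in a ball of radius \<open>2 r\<close>, and neighbouring centres are \<open>1/N\<close> apart, so \<open>r = 1/(4 N)\<close> is
  the largest scale for which these balls are disjoint.
\<close>

definition grid_bump :: "real ^ 'n::finite \<Rightarrow> nat \<Rightarrow> ('n \<Rightarrow> nat) \<Rightarrow> real ^ 'n \<Rightarrow> real" where
  "grid_bump e N m = bump_at e (1 / (4 * real N)) (grid_centre N m)"

lemma grid_bump_disjoint:
  assumes "norm e = 1" "0 < N" "grid_bump e N m x \<noteq> 0" "grid_bump e N m' x \<noteq> 0"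
  shows "m = m'"
proof (rule ccontr)
  assume "m \<noteq> m'"
  have "x \<in> ball (grid_centre N m) (2 * (1 / (4 * real N)))"
       "x \<in> ball (grid_centre N m') (2 * (1 / (4 * real N)))"
    using bump_at_eq_0[of e "1 / (4 * real N)"] assms unfolding grid_bump_def by force+
  then have "dist (grid_centre N m) x + dist (grid_centre N m') x < 1 / real N"
    by (simp add: field_simps)
  moreover have "dist (grid_centre N m) (grid_centre N m') \<le> dist (grid_centre N m) x + dist (grid_centre N m') x"
    by (rule dist_triangle2)
  ultimately show False
    using grid_centre_separated[OF \<open>m \<noteq> m'\<close> assms(2)] by linarith
qed

section \<open>Pairing with disjointly supported functions\<close>

text \<open>
  Two points meet at most two of the supports, so signed sums are no steeper than twice a single summand,
  however many summands there are.
\<close>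

lemma lipschitz_on_disjoint_sum:
  fixes f :: "'j \<Rightarrow> 'a::metric_space \<Rightarrow> real"
  assumes J: "finite J" and L: "0 \<le> L"
    and lip: "\<And>j. j \<in> J \<Longrightarrow> L-lipschitz_on S (f j)"
    and disj: "\<And>i j x. i \<in> J \<Longrightarrow> j \<in> J \<Longrightarrow> x \<in> S \<Longrightarrow> f i x \<noteq> 0 \<Longrightarrow> f j x \<noteq> 0 \<Longrightarrow> i = j"
    and sgn: "\<And>j. j \<in> J \<Longrightarrow> \<bar>\<sigma> j\<bar> \<le> 1"
  shows "(2 * L)-lipschitz_on S (\<lambda>x. \<Sum>j\<in>J. \<sigma> j * f j x)"
proof (rule lipschitz_onI)
  fix x y assume xy: "x \<in> S" "y \<in> S"
  define A where "A z = {j \<in> J. f j z \<noteq> 0}" for z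
  have fin: "finite (A z)" for z using J by (simp add: A_def)
  have card: "card (A z) \<le> 1" if "z \<in> S" for z
    using card_le_Suc0_iff_eq[OF fin[of z]] disj that by (auto simp: A_def)
  have "card (A x \<union> A y) \<le> 2"
    using card_Un_le[of "A x" "A y"] card[OF xy(1)] card[OF xy(2)] by linarith
  have "(\<Sum>j\<in>J. \<sigma> j * f j x) - (\<Sum>j\<in>J. \<sigma> j * f j y) = (\<Sum>j\<in>J. \<sigma> j * (f j x - f j y))"
    by (simp add: sum_subtractf right_diff_distrib)
  also have "\<dots> = (\<Sum>j\<in>A x \<union> A y. \<sigma> j * (f j x - f j y))"
    using J by (intro sum.mono_neutral_right) (auto simp: A_def)
  finally have "\<bar>(\<Sum>j\<in>J. \<sigma> j * f j x) - (\<Sum>j\<in>J. \<sigma> j * f j y)\<bar>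
      \<le> (\<Sum>j\<in>A x \<union> A y. \<bar>\<sigma> j * (f j x - f j y)\<bar>)"
    by simp
  also have "\<dots> \<le> (\<Sum>j\<in>A x \<union> A y. L * dist x y)"
  proof (rule sum_mono)
    fix j assume "j \<in> A x \<union> A y"
    then have j: "j \<in> J" by (auto simp: A_def)
    have "\<bar>\<sigma> j\<bar> * \<bar>f j x - f j y\<bar> \<le> 1 * (L * dist x y)"
      using sgn[OF j] lipschitz_onD[OF lip[OF j] xy] by (intro mult_mono) (auto simp: dist_real_def)
    then show "\<bar>\<sigma> j * (f j x - f j y)\<bar> \<le> L * dist x y"
      by (simp add: abs_mult)
  qed
  also have "\<dots> = real (card (A x \<union> A y)) * (L * dist x y)"
    by simp
  also have "\<dots> \<le> 2 * (L * dist x y)"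
    using \<open>card (A x \<union> A y) \<le> 2\<close> L by (intro mult_right_mono) auto
  finally show "dist (\<Sum>j\<in>J. \<sigma> j * f j x) (\<Sum>j\<in>J. \<sigma> j * f j y) \<le> 2 * L * dist x y"
    by (simp add: dist_real_def mult.assoc)
qed (use L in simp)

text \<open>
  The signs of the coefficients turn \<open>\<Sum>j. \<bar>(f j, u)\<bar>\<close> into the pairing of \<open>u\<close> with a single Lipschitz function.
  Passing from the sum of squares to the square of this sum loses nothing in the worst case, where \<open>u\<close>
  meets one support only.
\<close>

lemma sum_inner_square_le_KR_norm:
  fixes u :: "real ^ 'n::finite \<Rightarrow> real"
  assumes J: "finite J" and L: "0 < L"
    and lip: "\<And>j. j \<in> J \<Longrightarrow> L-lipschitz_on open_cube (f j)"
    and disj: "\<And>i j x. i \<in> J \<Longrightarrow> j \<in> J \<Longrightarrow> f i x \<noteq> 0 \<Longrightarrow> f j x \<noteq> 0 \<Longrightarrow> i = j"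
    and u: "u \<in> L20"
  shows "(\<Sum>j\<in>J. (l2_inner (f j) u)\<^sup>2) \<le> (2 * L * KR_norm u)\<^sup>2"
proof -
  define \<sigma> where "\<sigma> j = sgn (l2_inner (f j) u)" for j
  have "(2 * L)-lipschitz_on open_cube (\<lambda>x. \<Sum>j\<in>J. \<sigma> j * f j x)"
    using J L lip disj by (intro lipschitz_on_disjoint_sum) (auto simp: \<sigma>_def sgn_if)
  then have le: "(\<integral>x. u x * (\<Sum>j\<in>J. \<sigma> j * f j x) \<partial>cube_measure) \<le> 2 * L * KR_norm u"
    using u L by (intro lipschitz_pairing_le_KR_norm) auto
  have "(\<Sum>j\<in>J. \<bar>l2_inner (f j) u\<bar>) = (\<Sum>j\<in>J. \<sigma> j * l2_inner u (f j))"
    unfolding \<sigma>_def l2_inner_commute[of u] by (intro sum.cong) (auto simp: sgn_if)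
  also have "\<dots> = l2_inner u (\<lambda>x. \<Sum>j\<in>J. \<sigma> j * f j x)"
    using lip u by (intro l2_inner_sum_right[symmetric]) (auto intro: lipschitz_square_int L20_square_int)
  also have "\<dots> \<le> 2 * L * KR_norm u"
    using le by (simp add: l2_inner_def)
  finally have *: "(\<Sum>j\<in>J. \<bar>l2_inner (f j) u\<bar>) \<le> 2 * L * KR_norm u" .
  have "(\<Sum>j\<in>J. (l2_inner (f j) u)\<^sup>2) = (\<Sum>j\<in>J. \<bar>l2_inner (f j) u\<bar> * \<bar>l2_inner (f j) u\<bar>)"
    by (simp add: power2_eq_square)
  also have "\<dots> \<le> (\<Sum>j\<in>J. \<bar>l2_inner (f j) u\<bar> * (\<Sum>i\<in>J. \<bar>l2_inner (f i) u\<bar>))"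
    using J by (intro sum_mono mult_left_mono member_le_sum) auto
  also have "\<dots> = (\<Sum>j\<in>J. \<bar>l2_inner (f j) u\<bar>)\<^sup>2"
    by (simp add: sum_distrib_right[symmetric] power2_eq_square)
  also have "\<dots> \<le> (2 * L * KR_norm u)\<^sup>2"
    using * by (intro power_mono) (auto intro: sum_nonneg)
  finally show ?thesis .
qed

text \<open>
  The common bound \<open>V\<close> stands in for the squared norms: \<open>u\<close> is compared with the combination of the \<open>f j\<close> with
  coefficients \<open>(f j, u) / V\<close> instead of with its projection.
\<close>

lemma Bessel_orthogonal:
  assumes J: "finite J" and V: "0 < V"
    and sq: "\<And>j. j \<in> J \<Longrightarrow> square_int (f j)"
    and orth: "\<And>i j. i \<in> J \<Longrightarrow> j \<in> J \<Longrightarrow> i \<noteq> j \<Longrightarrow> l2_inner (f i) (f j) = 0"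
    and le: "\<And>j. j \<in> J \<Longrightarrow> l2_inner (f j) (f j) \<le> V"
    and u: "square_int u"
  shows "(\<Sum>j\<in>J. (l2_inner (f j) u)\<^sup>2) \<le> V * l2_inner u u"
proof -
  define a where "a j = l2_inner (f j) u" for j
  define g where "g x = (\<Sum>j\<in>J. a j / V * f j x)" for x
  define S where "S = (\<Sum>j\<in>J. (a j)\<^sup>2)"
  have g: "square_int g"
    unfolding g_def using sq by (intro square_int_sum square_int_cmult)
  have ug: "l2_inner u g = S / V"
  proof -
    have "l2_inner u g = (\<Sum>j\<in>J. a j / V * l2_inner u (f j))"
      unfolding g_def using sq u by (intro l2_inner_sum_right)
    then show ?thesis
      by (simp add: S_def a_def l2_inner_commute[of u] sum_divide_distrib power2_eq_square)
  qed
  have gf: "l2_inner g (f j) = a j / V * l2_inner (f j) (f j)" if "j \<in> J" for j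
  proof -
    have "l2_inner g (f j) = (\<Sum>i\<in>J. a i / V * l2_inner (f i) (f j))"
      unfolding g_def using sq that by (intro l2_inner_sum_left) auto
    also have "\<dots> = (\<Sum>i\<in>J. if i = j then a i / V * l2_inner (f i) (f j) else 0)"
      using orth that by (intro sum.cong) auto
    finally show ?thesis using J that by simp
  qed
  have "l2_inner g g = (\<Sum>j\<in>J. a j / V * l2_inner g (f j))"
  proof -
    have "g = (\<lambda>x. \<Sum>j\<in>J. a j / V * f j x)" by (simp add: g_def fun_eq_iff)
    then show ?thesis
      using l2_inner_sum_right[where f = f and S = J and c = "\<lambda>j. a j / V", OF sq g] by simp
  qed
  also have "\<dots> = (\<Sum>j\<in>J. (a j / V)\<^sup>2 * l2_inner (f j) (f j))"
    by (simp add: gf power2_eq_square mult.assoc)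
  also have "\<dots> \<le> (\<Sum>j\<in>J. (a j / V)\<^sup>2 * V)"
    using le by (intro sum_mono mult_left_mono) auto
  also have "\<dots> = S / V"
    using V by (simp add: S_def sum_divide_distrib power2_eq_square)
  finally have gg: "l2_inner g g \<le> S / V" .
  have "0 \<le> l2_inner (\<lambda>x. u x - g x) (\<lambda>x. u x - g x)"
    by (rule l2_inner_self_nonneg)
  also have "\<dots> = l2_inner u u - 2 * (S / V) + l2_inner g g"
    using u g by (simp add: l2_inner_diff_self ug)
  finally have "S / V \<le> l2_inner u u" using gg by linarith
  then show ?thesis using V by (simp add: S_def a_def field_simps)
qed

section \<open>Divergence at the critical exponent\<close>

text \<open>
  Every term of \<open>\<Sum>k. S k N\<close> tends to zero as the grid is refined and is dominated by a multiple of
  \<open>KR_norm (u k) powr \<alpha>\<close>, yet the sum is at least \<open>b * v\<close> for every grid.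
\<close>

theorem KR_norm_powr_diverges:
  fixes u :: "nat \<Rightarrow> real ^ 'n::finite \<Rightarrow> real" and \<alpha> :: real
  assumes alpha: "\<alpha> = 2 * real CARD('n) / (real CARD('n) + 2)"
    and u: "\<And>k. u k \<in> L20"
    and bounded: "\<And>k. l2_inner (u k) (u k) \<le> B"
    and b: "0 < b"
    and lower: "\<And>f. f \<in> L20 \<Longrightarrow> ennreal (b * (l2_norm f)\<^sup>2) \<le> (\<Sum>k. ennreal (\<bar>l2_inner f (u k)\<bar>\<^sup>2))"
  shows "(\<Sum>k. ennreal (KR_norm (u k) powr \<alpha>)) = \<infinity>"
proof (rule ccontr)
  assume "(\<Sum>k. ennreal (KR_norm (u k) powr \<alpha>)) \<noteq> \<infinity>"
  then have summ: "summable (\<lambda>k. KR_norm (u k) powr \<alpha>)"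
    by (intro summable_suminf_not_top) (auto simp: infinity_ennreal_def)
  let ?d = "CARD('n)"
  let ?w = "unit_ball_vol (real ?d)"
  define e :: "real ^ 'n" where "e = axis undefined 1"
  have e: "norm e = 1" by (simp add: e_def)
  define J :: "nat \<Rightarrow> ('n \<Rightarrow> nat) set" where "J N = PiE UNIV (\<lambda>_. {..<N})" for N
  have J: "finite (J N)" "card (J N) = N ^ ?d" and J_less: "m \<in> J N \<Longrightarrow> m i < N" for N m i
    by (auto simp: J_def card_PiE intro!: finite_PiE)
  define V where "V = ?w * (1/2) ^ ?d"
  define v where "v = ?w * (1/8) ^ ?d / 4"
  have Vv: "0 < V" "0 < v" by (simp_all add: V_def v_def)
  define S where "S k N = (\<Sum>m\<in>J N. (l2_inner (grid_bump e N m) (u k))\<^sup>2)" for k N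
  have B: "0 \<le> B" using bounded[of 0] l2_inner_self_nonneg[of "u 0"] by linarith
  define C where "C = (V * B) powr (2 / (real ?d + 2)) * 256 powr (real ?d / (real ?d + 2))"
  have kr: "0 \<le> KR_norm (u k)" for k using u by (rule KR_norm_nonneg)
  have S_nonneg: "0 \<le> S k N" for k N by (simp add: S_def sum_nonneg)
  have L20: "grid_bump e N m \<in> L20"
    and upper: "l2_inner (grid_bump e N m) (grid_bump e N m) \<le> V / real N ^ ?d"
    and lower': "v / real N ^ ?d \<le> l2_inner (grid_bump e N m) (grid_bump e N m)"
    if "m \<in> J N" for N m
  proof -
    have N: "0 < N" using J_less[OF that] by (metis gr_zeroI not_less_zero)
    then have r: "0 < 1 / (4 * real N)" by simp
    have sub: "ball (grid_centre N m) (2 * (1 / (4 * real N))) \<subseteq> open_cube"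
      using grid_centre_ball_subset[OF J_less[OF that]] by simp
    show "grid_bump e N m \<in> L20"
      unfolding grid_bump_def by (rule bump_at_L20[OF e r sub])
    show "l2_inner (grid_bump e N m) (grid_bump e N m) \<le> V / real N ^ ?d"
    proof -
      have "2 * (1 / (4 * real N)) = (1/2) / real N" by simp
      then have "(2 * (1 / (4 * real N))) ^ ?d = (1/2) ^ ?d / real N ^ ?d"
        by (simp only: power_divide)
      then show ?thesis
        using bump_at_l2_bounds(1)[OF e r sub] by (simp only: grid_bump_def V_def times_divide_eq_right)
    qed
    have "1 / (4 * real N) / 2 = (1/8) / real N" by simp
    then have "(1 / (4 * real N) / 2) ^ ?d = (1/8) ^ ?d / real N ^ ?d"
      by (simp only: power_divide)
    then show "v / real N ^ ?d \<le> l2_inner (grid_bump e N m) (grid_bump e N m)"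
      using bump_at_l2_bounds(2)[OF e r sub] by (simp add: grid_bump_def v_def)
  qed
  have disj: "i = j" if "0 < N" "grid_bump e N i x \<noteq> 0" "grid_bump e N j x \<noteq> 0" for N i j x
    using e that by (rule grid_bump_disjoint)
  have S_le_Bessel: "S k N \<le> V * B / real N ^ ?d" if N: "0 < N" for k N
  proof -
    have "S k N \<le> V / real N ^ ?d * l2_inner (u k) (u k)"
      unfolding S_def
    proof (rule Bessel_orthogonal)
      fix i j :: "'n \<Rightarrow> nat" assume "i \<noteq> j"
      then have "grid_bump e N i x * grid_bump e N j x = 0" for x
        using disj[OF N, of i x j] by auto
      then show "l2_inner (grid_bump e N i) (grid_bump e N j) = 0"
        by (simp only: l2_inner_def) simp
    qed (use J Vv N upper L20_square_int[OF L20] L20_square_int[OF u] in auto)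
    also have "\<dots> \<le> V / real N ^ ?d * B"
      using bounded Vv by (intro mult_left_mono) auto
    finally show ?thesis by simp
  qed
  have S_le_KR: "S k N \<le> 256 * (real N)\<^sup>2 * (KR_norm (u k))\<^sup>2" if N: "0 < N" for k N
  proof -
    have "(8 * real N)-lipschitz_on open_cube (grid_bump e N m)" for m
      using bump_at_lipschitz[of "1 / (4 * real N)" open_cube e "grid_centre N m"] N
      by (simp add: grid_bump_def)
    then have "S k N \<le> (2 * (8 * real N) * KR_norm (u k))\<^sup>2"
      unfolding S_def using J N disj[OF N] u by (intro sum_inner_square_le_KR_norm) auto
    then show ?thesis by (simp add: power_mult_distrib)
  qed
  \<comment> \<open>The weights of the geometric mean are those for which the powers of \<open>N\<close> cancel: \<open>- d * s + 2 * t = 0\<close>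
    and \<open>s + t = 1\<close>. The power of the norm is then \<open>2 * t = \<alpha>\<close>.\<close>
  have S_le: "S k N \<le> C * KR_norm (u k) powr \<alpha>" if N: "0 < N" for k N
  proof -
    let ?s = "2 / (real ?d + 2)" and ?t = "real ?d / (real ?d + 2)"
    have "real ?d + 2 \<noteq> 0" using of_nat_0_le_iff[of ?d] by linarith
    then have st: "?s + ?t = 1" by (simp add: add_divide_distrib[symmetric] add.commute)
    have "S k N = S k N powr ?s * S k N powr ?t"
      using S_nonneg[of k N] powr_add[of "S k N" ?s ?t] unfolding st by simp
    also have "\<dots> \<le> (V * B / real N ^ ?d) powr ?s * (256 * (real N)\<^sup>2 * (KR_norm (u k))\<^sup>2) powr ?t"
      using S_le_Bessel[OF N] S_le_KR[OF N] S_nonneg by (intro mult_mono powr_mono2) auto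
    also have "(V * B / real N ^ ?d) powr ?s = (V * B) powr ?s * real N powr (- real ?d * ?s)"
    proof -
      have "(real N ^ ?d) powr ?s = real N powr (real ?d * ?s)"
        using powr_powr[of "real N" "real ?d" ?s] powr_realpow[of "real N" ?d] N by simp
      then show ?thesis
        using B Vv by (simp add: powr_divide powr_minus_divide)
    qed
    also have "(256 * (real N)\<^sup>2 * (KR_norm (u k))\<^sup>2) powr ?t
        = 256 powr ?t * real N powr (2 * ?t) * KR_norm (u k) powr (2 * ?t)"
    proof -
      have "x\<^sup>2 powr ?t = x powr (2 * ?t)" if "0 \<le> x" for x :: real
        using powr_powr[of x 2 ?t] that by simp
      with kr[of k] show ?thesis by (simp only: powr_mult of_nat_0_le_iff)
    qed
    also have "(V * B) powr ?s * real N powr (- real ?d * ?s)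
        * (256 powr ?t * real N powr (2 * ?t) * KR_norm (u k) powr (2 * ?t))
        = C * (real N powr (- real ?d * ?s) * real N powr (2 * ?t)) * KR_norm (u k) powr (2 * ?t)"
      by (simp add: C_def)
    also have "real N powr (- real ?d * ?s) * real N powr (2 * ?t) = 1"
      using N by (simp add: powr_add[symmetric])
    also have "2 * ?t = \<alpha>" by (simp add: alpha)
    finally show ?thesis by simp
  qed
  have lim: "(\<lambda>N. S k N) \<longlonglongrightarrow> 0" for k
  proof (rule real_tendsto_sandwich)
    show "\<forall>\<^sub>F N in sequentially. 0 \<le> S k N" using S_nonneg by simp
    show "\<forall>\<^sub>F N in sequentially. S k N \<le> V * B / real N ^ ?d"
      using eventually_gt_at_top[of 0] by eventually_elim (rule S_le_Bessel)
    show "(\<lambda>N. V * B / real N ^ ?d) \<longlonglongrightarrow> 0"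
      by (intro tendsto_divide_0[OF tendsto_const] filterlim_at_top_imp_at_infinity filterlim_pow_at_top
          filterlim_real_sequentially) simp
  qed simp
  have ev: "\<forall>\<^sub>F (k, N) in sequentially \<times>\<^sub>F sequentially. norm (S k N) \<le> C * KR_norm (u k) powr \<alpha>"
  proof -
    have "\<forall>\<^sub>F (k::nat, N::nat) in sequentially \<times>\<^sub>F sequentially. 0 < N"
      by (subst eventually_prod2) (auto intro: eventually_gt_at_top)
    then show ?thesis
      by eventually_elim (use S_le S_nonneg in auto)
  qed
  have "(\<lambda>N. \<Sum>k. S k N) \<longlonglongrightarrow> (\<Sum>k. 0)"
    using tannerys_theorem[OF lim ev summable_mult[OF summ]] by auto
  then have lim0: "(\<lambda>N. \<Sum>k. S k N) \<longlonglongrightarrow> 0" by simp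
  \<comment> \<open>The lower frame bound, added up over the \<open>N ^ d\<close> bumps.\<close>
  have "b * v \<le> (\<Sum>k. S k N)" if N: "0 < N" for N
  proof -
    have summS: "summable (\<lambda>k. S k N)"
    proof (rule summable_comparison_test'[OF summable_mult[OF summ, of C]])
      show "norm (S k N) \<le> C * KR_norm (u k) powr \<alpha>" if "0 \<le> k" for k
        using S_le[OF N, of k] S_nonneg[of k N] by simp
    qed
    have "b * v = (\<Sum>m\<in>J N. b * (v / real N ^ ?d))"
      using N by (simp add: J(2))
    moreover have "0 \<le> b * (v / real N ^ ?d)"
      using b Vv by simp
    ultimately have "ennreal (b * v) = (\<Sum>m\<in>J N. ennreal (b * (v / real N ^ ?d)))"
      using sum_ennreal[of "J N" "\<lambda>_. b * (v / real N ^ ?d)"] by simp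
    also have "\<dots> \<le> (\<Sum>m\<in>J N. \<Sum>k. ennreal (\<bar>l2_inner (grid_bump e N m) (u k)\<bar>\<^sup>2))"
    proof (rule sum_mono)
      fix m assume m: "m \<in> J N"
      have "b * (v / real N ^ ?d) \<le> b * (l2_norm (grid_bump e N m))\<^sup>2"
        unfolding l2_norm_square using b lower'[OF m] by (intro mult_left_mono) auto
      then show "ennreal (b * (v / real N ^ ?d)) \<le> (\<Sum>k. ennreal (\<bar>l2_inner (grid_bump e N m) (u k)\<bar>\<^sup>2))"
        by (rule order_trans[OF ennreal_leI lower[OF L20[OF m]]])
    qed
    also have "\<dots> = (\<Sum>k. \<Sum>m\<in>J N. ennreal (\<bar>l2_inner (grid_bump e N m) (u k)\<bar>\<^sup>2))"
      by (rule suminf_sum[symmetric]) simp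
    also have "\<dots> = (\<Sum>k. ennreal (S k N))"
      by (simp only: S_def power2_abs sum_ennreal[OF zero_le_power2])
    also have "\<dots> = ennreal (\<Sum>k. S k N)"
      using S_nonneg summS by (intro suminf_ennreal2)
    finally show ?thesis
      using suminf_nonneg[OF summS S_nonneg] by (simp only: ennreal_le_iff)
  qed
  then have "\<forall>\<^sub>F N in sequentially. b * v \<le> (\<Sum>k. S k N)"
    by (rule eventually_mono[OF eventually_gt_at_top])
  then have "b * v \<le> 0"
    by (rule tendsto_lowerbound[OF lim0]) simp
  then show False using b Vv by (simp add: mult_le_0_iff)
qed

section \<open>Frames and Riesz bases\<close>

text \<open>
  Testing the upper frame bound on \<open>u k\<close> itself and keeping only the \<open>k\<close>-th term gives
  \<open>\<parallel>u k\<parallel> ^ 4 \<le> B * \<parallel>u k\<parallel>\<^sup>2\<close>.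
\<close>

lemma frame_norm_bound:
  assumes "l2_frame u"
  obtains b B where "0 < b" "\<And>k. l2_inner (u k) (u k) \<le> B"
    "\<And>f. f \<in> L20 \<Longrightarrow> ennreal (b * (l2_norm f)\<^sup>2) \<le> (\<Sum>k. ennreal (\<bar>l2_inner f (u k)\<bar>\<^sup>2))"
proof -
  have u: "u k \<in> L20" for k
    using assms unfolding l2_frame_def by (elim conjE allE)
  obtain b B where bB: "0 < b" "b \<le> B"
    and frame: "\<forall>f\<in>L20. ennreal (b * (l2_norm f)\<^sup>2) \<le> (\<Sum>k. ennreal (\<bar>l2_inner f (u k)\<bar>\<^sup>2)) \<and>
      (\<Sum>k. ennreal (\<bar>l2_inner f (u k)\<bar>\<^sup>2)) \<le> ennreal (B * (l2_norm f)\<^sup>2)"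
    using assms unfolding l2_frame_def by (elim conjE exE) (rule that; assumption)
  have "l2_inner (u k) (u k) \<le> B" for k
  proof -
    let ?s = "l2_inner (u k) (u k)"
    have "ennreal (\<bar>?s\<bar>\<^sup>2) \<le> (\<Sum>i. ennreal (\<bar>l2_inner (u k) (u i)\<bar>\<^sup>2))"
    proof -
      have "(\<Sum>i\<in>{k}. ennreal (\<bar>l2_inner (u k) (u i)\<bar>\<^sup>2)) \<le> (\<Sum>i. ennreal (\<bar>l2_inner (u k) (u i)\<bar>\<^sup>2))"
        by (rule sum_le_suminf) (rule summableI finite.intros zero_le)+
      then show ?thesis by (simp only: sum.insert sum.empty finite.emptyI empty_iff not_False_eq_True add_0_right)
    qed
    also have "\<dots> \<le> ennreal (B * ?s)"
      using frame[rule_format, OF u, of k] by (simp only: l2_norm_square)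
    finally have "\<bar>?s\<bar>\<^sup>2 \<le> B * ?s"
      using bB l2_inner_self_nonneg[of "u k"] by (subst (asm) ennreal_le_iff) auto
    then have *: "?s * ?s \<le> B * ?s"
      by (simp only: power2_abs power2_eq_square)
    show ?thesis
    proof (cases "?s = 0")
      case False
      then have "0 < ?s" using l2_inner_self_nonneg[of "u k"] by linarith
      with * show ?thesis by simp
    qed (use bB in simp)
  qed
  from bB(1) this show ?thesis
    by (rule that) (rule frame[rule_format, THEN conjunct1])
qed

lemma bounded_linear_l2_combination:
  assumes "l2_bounded_linear T" "f \<in> L20" "g \<in> L20"
  shows "AE x in cube_measure. T (\<lambda>y. a * f y + b * g y) x = a * T f x + b * T g x"
  using assms(1)[unfolded l2_bounded_linear_def, THEN conjunct2, THEN conjunct1, rule_format, OF assms(2,3)] .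

lemma bounded_linear_l2_sum:
  assumes T: "l2_bounded_linear T" and e: "\<And>k. e k \<in> L20"
  shows "AE x in cube_measure. T (\<lambda>y. \<Sum>k<(N::nat). c k * e k y) x = (\<Sum>k<N. c k * T (e k) x)"
proof (induction N)
  case 0
  from bounded_linear_l2_combination[OF T e e, of 0 0 0 0] show ?case by simp
next
  case (Suc N)
  have "(\<lambda>y. \<Sum>k<N. c k * e k y) \<in> L20"
    using e by (intro L20_sum L20_cmult)
  from bounded_linear_l2_combination[OF T this e, of 1 "c N" N] Suc.IH show ?case
    by eventually_elim simp
qed

lemma l2_inner_orthonormal_sum:
  assumes e: "\<And>k. square_int (e k)"
    and orth: "\<And>j k. l2_inner (e j) (e k) = (if j = k then 1 else 0)"
  shows "l2_inner (\<lambda>x. \<Sum>k<(N::nat). c k * e k x) (\<lambda>x. \<Sum>k<N. c k * e k x) = (\<Sum>k<N. (c k)\<^sup>2)"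
proof -
  let ?p = "\<lambda>x. \<Sum>k<N. c k * e k x"
  have p: "square_int ?p"
    using e by (intro square_int_sum square_int_cmult)
  have "l2_inner ?p (e k) = c k" if "k < N" for k
  proof -
    have "l2_inner ?p (e k) = (\<Sum>i<N. c i * l2_inner (e i) (e k))"
      by (rule l2_inner_sum_left[OF e e])
    also have "\<dots> = (\<Sum>i<N. if i = k then c i else 0)"
      by (intro sum.cong) (auto simp: orth)
    finally show ?thesis using that by simp
  qed
  moreover have "l2_inner ?p ?p = (\<Sum>k<N. c k * l2_inner ?p (e k))"
    by (rule l2_inner_sum_right[OF e p])
  ultimately show ?thesis
    by (simp add: power2_eq_square)
qed

text \<open>
  Writing \<open>f = T (S f)\<close> and expanding \<open>S f\<close> in the orthonormal basis expresses \<open>f\<close> through the \<open>u k\<close>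
  with coefficients of \<open>\<ell>\<^sup>2\<close> norm at most \<open>\<parallel>S f\<parallel>\<close>; pairing this expansion with \<open>f\<close> itself gives the lower
  bound, without an adjoint of \<open>T\<close>.
\<close>

lemma riesz_basis_lower_bound:
  fixes u :: "nat \<Rightarrow> real ^ 'n::finite \<Rightarrow> real"
  assumes "l2_riesz_basis u"
  obtains b B where "0 < b" "\<And>k. l2_inner (u k) (u k) \<le> B"
    "\<And>f. f \<in> L20 \<Longrightarrow> ennreal (b * (l2_norm f)\<^sup>2) \<le> (\<Sum>k. ennreal (\<bar>l2_inner f (u k)\<bar>\<^sup>2))"
proof -
  have u: "u k \<in> L20" for k
    using assms unfolding l2_riesz_basis_def by (elim conjE allE)
  obtain e T where basis: "l2_orthonormal_basis e" and iso: "l2_isomorphism T"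
    and uT: "\<forall>k. AE x in cube_measure. u k x = T (e k) x"
    using assms unfolding l2_riesz_basis_def by (elim conjE exE) (rule that; assumption)
  have T: "l2_bounded_linear T"
    using iso unfolding l2_isomorphism_def by (rule conjunct1)
  obtain S where S: "l2_bounded_linear S"
    and TS: "\<forall>f\<in>L20. (AE x in cube_measure. S (T f) x = f x) \<and> (AE x in cube_measure. T (S f) x = f x)"
    using iso unfolding l2_isomorphism_def by (elim conjE exE) (rule that; assumption)
  note basis' = basis[unfolded l2_orthonormal_basis_def]
  have e: "e k \<in> L20" for k
    using basis' by (elim conjE allE)
  have orth: "l2_inner (e j) (e k) = (if j = k then 1 else 0)" for j k
    using basis'[THEN conjunct2, THEN conjunct1] by (elim allE)
  have dense: "\<exists>N c. l2_norm (\<lambda>x. f x - (\<Sum>k<N. c k * e k x)) < \<epsilon>" if "f \<in> L20" "0 < \<epsilon>" for f \<epsilon>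
    using basis'[THEN conjunct2, THEN conjunct2, rule_format, OF that] .
  have TL: "T f \<in> L20" and SL: "S f \<in> L20" if "f \<in> L20" for f
    using T[unfolded l2_bounded_linear_def, THEN conjunct1, rule_format, OF that]
      S[unfolded l2_bounded_linear_def, THEN conjunct1, rule_format, OF that] .
  obtain C0 where C0: "\<forall>f\<in>L20. l2_norm (T f) \<le> C0 * l2_norm f"
    using T unfolding l2_bounded_linear_def by (elim conjE exE) (rule that; assumption)
  obtain D0 where D0: "\<forall>f\<in>L20. l2_norm (S f) \<le> D0 * l2_norm f"
    using S unfolding l2_bounded_linear_def by (elim conjE exE) (rule that; assumption)
  define C where "C = \<bar>C0\<bar>"
  define D where "D = \<bar>D0\<bar> + 1"
  have CD: "0 \<le> C" "0 < D" unfolding C_def D_def by linarith+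
  have normT: "l2_norm (T f) \<le> C * l2_norm f" if "f \<in> L20" for f
    by (rule order_trans[OF C0[rule_format, OF that] mult_right_mono[OF _ l2_norm_nonneg]]) (simp add: C_def)
  have normS: "l2_norm (S f) \<le> D * l2_norm f" if "f \<in> L20" for f
    by (rule order_trans[OF D0[rule_format, OF that] mult_right_mono[OF _ l2_norm_nonneg]]) (simp add: D_def)

  have bounded: "l2_inner (u k) (u k) \<le> C\<^sup>2" for k
  proof -
    have "l2_inner (u k) (u k) = (l2_norm (T (e k)))\<^sup>2"
      unfolding l2_norm_square
      by (rule l2_inner_cong_AE) (rule uT[rule_format] L20_square_int u TL e)+
    also have "\<dots> \<le> (C * l2_norm (e k))\<^sup>2"
      using normT[OF e[of k]] by (intro power_mono l2_norm_nonneg)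
    also have "\<dots> = C\<^sup>2"
      unfolding l2_norm_def orth by simp
    finally show ?thesis .
  qed

  have key: "(l2_norm f)\<^sup>2 \<le> D * l2_norm f * sqrt s"
    if f: "f \<in> L20" and s: "\<And>N. (\<Sum>k<N. (l2_inner f (u k))\<^sup>2) \<le> s" for f s
  proof -
    have "(l2_norm f)\<^sup>2 \<le> l2_norm (S f) * sqrt s + \<delta>" if \<delta>: "0 < \<delta>" for \<delta>
    proof -
      have s0: "0 \<le> s" using s[of 0] by simp
      \<comment> \<open>Approximating \<open>S f\<close> up to \<open>\<epsilon>\<close> costs \<open>\<epsilon> * sqrt s\<close> in the coefficients and \<open>\<epsilon> * C * \<parallel>f\<parallel>\<close> after applying
        \<open>T\<close> and pairing with \<open>f\<close>; together \<open>\<epsilon> * K\<close>.\<close>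
      define K where "K = sqrt s + l2_norm f * C"
      have K: "0 \<le> K" using s0 CD l2_norm_nonneg[of f] by (simp add: K_def)
      define \<epsilon> where "\<epsilon> = \<delta> / (K + 1)"
      have \<epsilon>: "0 < \<epsilon>" unfolding \<epsilon>_def using \<delta> K by simp
      have "\<epsilon> * K \<le> \<epsilon> * (K + 1)" using \<epsilon> by (intro mult_left_mono) auto
      also have "\<dots> = \<delta>" unfolding \<epsilon>_def using K by simp
      finally have \<epsilon>K: "\<epsilon> * K \<le> \<delta>" .
      obtain N c where Nc: "l2_norm (\<lambda>x. S f x - (\<Sum>k<N. c k * e k x)) < \<epsilon>"
        using dense[OF SL[OF f] \<epsilon>] by (elim exE) (rule that; assumption)
      define p where "p = (\<lambda>x. \<Sum>k<N. c k * e k x)"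
      define q where "q = (\<lambda>x. \<Sum>k<N. c k * u k x)"
      have p: "p \<in> L20" unfolding p_def using e by (intro L20_sum L20_cmult)
      have q: "q \<in> L20" unfolding q_def using u by (intro L20_sum L20_cmult)
      have diff: "(\<lambda>x. S f x - p x) \<in> L20" using SL[OF f] p by (rule L20_diff)
      have "p = (\<lambda>x. S f x + (-1) * (S f x - p x))" by (simp add: fun_eq_iff)
      then have "l2_norm p = l2_norm (\<lambda>x. S f x + (-1) * (S f x - p x))" by (rule arg_cong)
      also have "\<dots> \<le> l2_norm (S f) + l2_norm (\<lambda>x. (-1) * (S f x - p x))"
        by (rule l2_norm_triangle[OF L20_square_int[OF SL[OF f]] L20_square_int[OF L20_cmult[OF diff]]])
      finally have "l2_norm p \<le> l2_norm (S f) + l2_norm (\<lambda>x. (-1) * (S f x - p x))" .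
      moreover have "l2_norm (\<lambda>x. (-1) * (S f x - p x)) = l2_norm (\<lambda>x. S f x - p x)"
        unfolding l2_norm_def l2_inner_cmult_left l2_inner_cmult_right by simp
      ultimately have norm_p: "l2_norm p \<le> l2_norm (S f) + \<epsilon>"
        using Nc unfolding p_def by linarith

      \<comment> \<open>The partial sums of the \<open>u k\<close> approximate \<open>f\<close>.\<close>
      note bounded_linear_l2_combination[OF T SL[OF f] p, of 1 "-1"]
      moreover have "AE x in cube_measure. T p x = (\<Sum>k<N. c k * T (e k) x)"
        unfolding p_def by (rule bounded_linear_l2_sum[OF T e])
      moreover have "AE x in cube_measure. \<forall>k. u k x = T (e k) x"
        using uT by (subst AE_all_countable)
      ultimately have "AE x in cube_measure. f x - q x = T (\<lambda>x. S f x - p x) x"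
        using TS[rule_format, OF f, THEN conjunct2] by eventually_elim (simp add: q_def)
      from l2_inner_cong_AE[OF this this]
      have "l2_norm (\<lambda>x. f x - q x) = l2_norm (T (\<lambda>x. S f x - p x))"
        unfolding l2_norm_def using L20_square_int[OF L20_diff[OF f q]] L20_square_int[OF TL[OF diff]]
        by (intro arg_cong[where f = sqrt])
      also have "\<dots> \<le> C * l2_norm (\<lambda>x. S f x - p x)"
        by (rule normT[OF diff])
      also have "\<dots> \<le> C * \<epsilon>"
        using Nc CD by (intro mult_left_mono) (auto simp: p_def)
      finally have fq: "l2_norm (\<lambda>x. f x - q x) \<le> C * \<epsilon>" .

      have "(l2_norm f)\<^sup>2 = l2_inner (\<lambda>x. q x + (f x - q x)) f"
        by (simp add: l2_norm_square)
      also have "\<dots> = l2_inner q f + l2_inner (\<lambda>x. f x - q x) f"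
        using f q L20_diff[OF f q] by (intro l2_inner_add_left L20_square_int)
      also have "l2_inner (\<lambda>x. f x - q x) f \<le> C * \<epsilon> * l2_norm f"
      proof -
        have "\<bar>l2_inner (\<lambda>x. f x - q x) f\<bar> \<le> l2_norm (\<lambda>x. f x - q x) * l2_norm f"
          using f L20_diff[OF f q] by (intro l2_Cauchy_Schwarz L20_square_int)
        also have "\<dots> \<le> C * \<epsilon> * l2_norm f"
          using fq l2_norm_nonneg by (intro mult_right_mono)
        finally show ?thesis by simp
      qed
      also have "l2_inner q f \<le> (l2_norm (S f) + \<epsilon>) * sqrt s"
      proof -
        have "l2_inner q f = (\<Sum>k<N. c k * l2_inner f (u k))"
          unfolding q_def using u f
          by (subst l2_inner_commute, intro l2_inner_sum_right L20_square_int)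
        then have "(l2_inner q f)\<^sup>2 \<le> (\<Sum>k<N. (c k)\<^sup>2) * (\<Sum>k<N. (l2_inner f (u k))\<^sup>2)"
          using Cauchy_Schwarz_ineq_sum[of c "\<lambda>k. l2_inner f (u k)" "{..<N}"] by simp
        also have "(\<Sum>k<N. (c k)\<^sup>2) = (l2_norm p)\<^sup>2"
          unfolding l2_norm_square p_def
          by (rule l2_inner_orthonormal_sum[OF L20_square_int[OF e] orth, symmetric])
        also have "(l2_norm p)\<^sup>2 * (\<Sum>k<N. (l2_inner f (u k))\<^sup>2) \<le> (l2_norm (S f) + \<epsilon>)\<^sup>2 * (sqrt s)\<^sup>2"
          using norm_p s[of N] s0 by (intro mult_mono power_mono) (auto simp: l2_norm_nonneg sum_nonneg)
        finally have "(l2_inner q f)\<^sup>2 \<le> ((l2_norm (S f) + \<epsilon>) * sqrt s)\<^sup>2"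
          by (simp only: power_mult_distrib)
        then show ?thesis
          by (rule power2_le_imp_le) (use \<epsilon> s0 l2_norm_nonneg[of "S f"] in auto)
      qed
      finally have "(l2_norm f)\<^sup>2 \<le> l2_norm (S f) * sqrt s + \<epsilon> * K"
        by (simp add: K_def algebra_simps)
      with \<epsilon>K show ?thesis by linarith
    qed
    then have "(l2_norm f)\<^sup>2 \<le> l2_norm (S f) * sqrt s"
      by (rule field_le_epsilon)
    also have "\<dots> \<le> D * l2_norm f * sqrt s"
      using normS[OF f] s[of 0] by (intro mult_right_mono) auto
    finally show ?thesis .
  qed

  show thesis
  proof (rule that)
    show "0 < 1 / D\<^sup>2" using CD by simp
    show "l2_inner (u k) (u k) \<le> C\<^sup>2" for k by (rule bounded)
    show "ennreal (1 / D\<^sup>2 * (l2_norm f)\<^sup>2) \<le> (\<Sum>k. ennreal (\<bar>l2_inner f (u k)\<bar>\<^sup>2))" if f: "f \<in> L20" for f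
    proof (cases "(\<Sum>k. ennreal (\<bar>l2_inner f (u k)\<bar>\<^sup>2)) = top")
      case False
      then have summ: "summable (\<lambda>k. (l2_inner f (u k))\<^sup>2)"
        by (intro summable_suminf_not_top) auto
      define s where "s = (\<Sum>k. (l2_inner f (u k))\<^sup>2)"
      have "(\<Sum>k<N. (l2_inner f (u k))\<^sup>2) \<le> s" for N
        unfolding s_def using summ by (intro sum_le_suminf) auto
      then have k: "(l2_norm f)\<^sup>2 \<le> D * l2_norm f * sqrt s"
        by (rule key[OF f])
      have s0: "0 \<le> s" unfolding s_def using summ by (intro suminf_nonneg) auto
      have "l2_norm f \<le> D * sqrt s"
      proof (cases "l2_norm f = 0")
        case True
        then show ?thesis using CD s0 by simp
      next
        case False
        then have "0 < l2_norm f" using l2_norm_nonneg[of f] by linarith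
        moreover have "l2_norm f * l2_norm f \<le> l2_norm f * (D * sqrt s)"
          using k by (simp add: power2_eq_square mult.left_commute mult.assoc)
        ultimately show ?thesis by simp
      qed
      then have "(l2_norm f)\<^sup>2 \<le> (D * sqrt s)\<^sup>2"
        using l2_norm_nonneg by (intro power_mono)
      also have "\<dots> = D\<^sup>2 * s"
        using s0 by (simp add: power_mult_distrib)
      finally have "1 / D\<^sup>2 * (l2_norm f)\<^sup>2 \<le> s"
        using CD by (simp add: pos_divide_le_eq mult.commute)
      then have "ennreal (1 / D\<^sup>2 * (l2_norm f)\<^sup>2) \<le> ennreal s"
        by (rule ennreal_leI)
      also have "ennreal s = (\<Sum>k. ennreal (\<bar>l2_inner f (u k)\<bar>\<^sup>2))"
        unfolding s_def power2_abs using summ by (intro suminf_ennreal2[symmetric]) auto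
      finally show ?thesis .
    qed simp
  qed
qed

section \<open>A binary tree of dyadic boxes\<close>

definition split_axis :: "nat \<Rightarrow> 'n::finite" where
  "split_axis n = (SOME h. bij_betw h {0..<CARD('n)} UNIV) (n mod CARD('n))"

lemma split_axis_periodic:
  fixes j :: "'n::finite"
  obtains r where "r < CARD('n)" "\<And>q. split_axis (q * CARD('n) + r) = j"
proof -
  let ?h = "SOME h. bij_betw h {0..<CARD('n)} (UNIV :: 'n set)"
  have "bij_betw ?h {0..<CARD('n)} UNIV"
    by (rule someI_ex[OF ex_bij_betw_nat_finite]) simp
  then have "j \<in> ?h ` {0..<CARD('n)}"
    by (simp add: bij_betw_def)
  then obtain r where "r < CARD('n)" "?h r = j" by auto
  then have "split_axis (q * CARD('n) + r) = j" for q
    by (simp add: split_axis_def)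
  with \<open>r < CARD('n)\<close> show thesis by (rule that)
qed

definition side :: "nat \<Rightarrow> 'n::finite \<Rightarrow> real" where
  "side n j = (1/2) ^ card {i. i < n \<and> split_axis i = j}"

lemma side_0: "side 0 j = 1"
  by (simp add: side_def)

lemma side_pos: "0 < side n j"
  by (simp add: side_def)

lemma side_Suc: "side (Suc n) j = side n j * (if split_axis n = j then 1/2 else 1)"
proof (cases "split_axis n = j")
  case True
  then have "{i. i < Suc n \<and> split_axis i = j} = insert n {i. i < n \<and> split_axis i = j}"
    by auto
  with True show ?thesis by (simp add: side_def)
next
  case False
  then have "{i. i < Suc n \<and> split_axis i = j} = {i. i < n \<and> split_axis i = j}"
    using less_Suc_eq by auto
  with False show ?thesis by (simp add: side_def)
qed

lemma prod_side: "(\<Prod>j\<in>(UNIV::'n::finite set). side n j) = (1/2) ^ n"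
proof (induction n)
  case (Suc n)
  have "(\<Prod>j\<in>(UNIV::'n set). side (Suc n) j)
      = (\<Prod>j\<in>(UNIV::'n set). side n j) * (\<Prod>j\<in>(UNIV::'n set). if split_axis n = j then 1/2 else 1)"
    by (simp add: side_Suc prod.distrib)
  with Suc show ?case by simp
qed (simp add: side_0)

text \<open>Each direction is cut once in every full cycle of \<open>d\<close> cuts.\<close>

lemma side_le: "side n (j::'n::finite) \<le> (1/2) ^ (n div CARD('n))"
proof -
  obtain r where r: "r < CARD('n)" "\<And>q. split_axis (q * CARD('n) + r) = j"
    using split_axis_periodic[of j] by blast
  have inj: "inj_on (\<lambda>q. q * CARD('n) + r) {..<n div CARD('n)}"
    by (auto simp: inj_on_def)
  have sub: "(\<lambda>q. q * CARD('n) + r) ` {..<n div CARD('n)} \<subseteq> {i. i < n \<and> split_axis i = j}"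
  proof safe
    fix q assume "q < n div CARD('n)"
    then have "Suc q * CARD('n) \<le> n div CARD('n) * CARD('n)"
      by (intro mult_right_mono) auto
    also have "\<dots> \<le> n" by simp
    finally show "q * CARD('n) + r < n" using r(1) by simp
  qed (rule r(2))
  have "n div CARD('n) \<le> card {i. i < n \<and> split_axis i = j}"
    using card_mono[OF _ sub] card_image[OF inj] by simp
  then show ?thesis
    unfolding side_def by (intro power_decreasing) auto
qed

text \<open>
  Nodes of the tree carry heap indices: the root is \<open>1\<close>, the halves of node \<open>k\<close> are \<open>2 k\<close> and \<open>2 k + 1\<close>,
  so level \<open>n\<close> consists of the indices from \<open>2 ^ n\<close> to \<open>2 ^ (n + 1) - 1\<close>. Passing from level \<open>n\<close> to \<open>n + 1\<close>
  halves every box across the coordinate direction \<open>split_axis n\<close>; cycling through the directions keeps the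
  boxes from becoming thin.
\<close>

primrec corner :: "nat \<Rightarrow> nat \<Rightarrow> real ^ 'n::finite" where
  "corner 0 k = 0"
| "corner (Suc n) k = corner n (k div 2) +
    (if odd k then axis (split_axis n) (side (Suc n) (split_axis n :: 'n)) else 0)"

primrec node :: "nat \<Rightarrow> real ^ 'n::finite \<Rightarrow> nat" where
  "node 0 x = 1"
| "node (Suc n) x = 2 * node n x +
    (if corner n (node n x) $ (split_axis n :: 'n) + side (Suc n) (split_axis n :: 'n) \<le> x $ split_axis n then 1 else 0)"

lemma node_Suc_div_2: "node (Suc n) x div 2 = node n x"
  by simp

lemma node_range: "2 ^ n \<le> node n x \<and> node n x < 2 ^ Suc n"
  by (induction n) auto

lemma node_ancestor: "node n x = node (n + m) x div 2 ^ m"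
proof (induction m)
  case (Suc m)
  have "node (n + Suc m) x div 2 ^ Suc m = node (n + Suc m) x div 2 div 2 ^ m"
    by (simp only: power_Suc div_mult2_eq)
  also have "\<dots> = node (n + m) x div 2 ^ m"
    by (simp only: add_Suc_right node_Suc_div_2)
  finally show ?case using Suc by simp
qed simp

lemma corner_Suc_component:
  "corner (Suc n) k $ j = corner n (k div 2) $ j +
    (if odd k \<and> j = split_axis n then side (Suc n) j else 0)"
  by (auto simp: axis_def)

lemma corner_bounds: "0 \<le> corner n k $ j \<and> corner n k $ j + side n j \<le> 1"
proof (induction n arbitrary: k)
  case (Suc n)
  from Suc[of "k div 2"] side_pos[of n j] show ?case
    unfolding corner_Suc_component by (auto simp: side_Suc)
qed (simp add: side_0)

definition cell :: "nat \<Rightarrow> nat \<Rightarrow> (real ^ 'n::finite) set" where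
  "cell n k = {x. \<forall>j. corner n k $ j \<le> x $ j \<and> x $ j < corner n k $ j + side n j}"

lemma mem_cell_node:
  assumes "x \<in> open_cube"
  shows "x \<in> cell n (node n x)"
proof (induction n)
  case 0
  then show ?case using assms by (auto simp: cell_def open_cube_def side_0 less_imp_le)
next
  case (Suc n)
  have "corner (Suc n) (node (Suc n) x) $ j \<le> x $ j \<and>
      x $ j < corner (Suc n) (node (Suc n) x) $ j + side (Suc n) j" for j
  proof -
    have "corner n (node n x) $ j \<le> x $ j \<and> x $ j < corner n (node n x) $ j + side n j"
      using Suc by (simp add: cell_def)
    then show ?thesis
      unfolding corner_Suc_component node_Suc_div_2 by (auto simp: side_Suc split: if_splits)
  qed
  then show ?case unfolding cell_def by blast
qed

lemma node_eqI:
  fixes x :: "real ^ 'n::finite"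
  assumes "2 ^ n \<le> k" "k < 2 ^ Suc n" "x \<in> cell n k"
  shows "node n x = k"
  using assms
proof (induction n arbitrary: k)
  case (Suc n)
  have x: "corner (Suc n) k $ j \<le> x $ j" "x $ j < corner (Suc n) k $ j + side (Suc n) j" for j
    using Suc.prems(3) by (auto simp: cell_def)
  have "corner n (k div 2) $ j \<le> x $ j \<and> x $ j < corner n (k div 2) $ j + side n j" for j
    using x[of j] side_pos[of n j] unfolding corner_Suc_component
    by (auto simp: side_Suc split: if_splits)
  then have "x \<in> cell n (k div 2)" by (simp add: cell_def)
  then have k2: "node n x = k div 2"
    using Suc.prems by (intro Suc.IH) auto
  show ?case
  proof (cases "odd k")
    case True
    then have "(corner n (k div 2) :: real ^ 'n) $ split_axis n + side (Suc n) (split_axis n :: 'n) \<le> x $ split_axis n"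
      using x(1)[of "split_axis n :: 'n"] unfolding corner_Suc_component by simp
    with True k2 show ?thesis by simp
  next
    case False
    then have "x $ split_axis n < (corner n (k div 2) :: real ^ 'n) $ split_axis n + side (Suc n) (split_axis n :: 'n)"
      using x(2)[of "split_axis n :: 'n"] unfolding corner_Suc_component by simp
    with False k2 show ?thesis by simp
  qed
qed simp

declare node.simps(2) [simp del]

lemma dist_cell_le:
  fixes x :: "real ^ 'n::finite"
  assumes "x \<in> cell n k" "y \<in> cell n k"
  shows "dist x y \<le> real CARD('n) * (1/2) ^ (n div CARD('n))"
proof -
  have "dist x y \<le> (\<Sum>j\<in>UNIV. \<bar>(x - y) $ j\<bar>)"
    unfolding dist_norm by (rule norm_le_l1_cart)
  also have "\<dots> \<le> (\<Sum>j\<in>(UNIV::'n set). (1/2) ^ (n div CARD('n)))"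
  proof (rule sum_mono)
    fix j :: 'n
    have "\<bar>(x - y) $ j\<bar> \<le> side n j"
      using assms unfolding cell_def by (auto dest!: spec[of _ j])
    also have "\<dots> \<le> (1/2) ^ (n div CARD('n))"
      by (rule side_le)
    finally show "\<bar>(x - y) $ j\<bar> \<le> (1/2) ^ (n div CARD('n))" .
  qed
  finally show ?thesis by simp
qed

lemma corner_mem_cell: "corner n k \<in> cell n k"
  by (simp add: cell_def side_pos)

text \<open>
  A cell is a half-open box whose intersection with the open cube lies between an open box and its closure, so
  only the volume of boxes is needed.
\<close>

lemma cell_measure:
  fixes n k :: nat
  defines "A \<equiv> cell n k \<inter> (open_cube :: (real ^ 'n::finite) set)"
  shows "A \<in> sets lebesgue" "measure lebesgue A = (1/2) ^ n"
proof -
  define a b :: "real ^ 'n" where "a = corner n k" and "b = corner n k + (\<chi> j. side n j)"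
  have lt: "a $ j < b $ j" for j by (simp add: a_def b_def side_pos)
  have box: "box a b \<subseteq> A"
  proof
    fix x assume x: "x \<in> box a b"
    then have "corner n k $ j < x $ j \<and> x $ j < corner n k $ j + side n j" for j
      by (simp add: mem_box_cart a_def b_def)
    moreover from this have "0 < x $ j \<and> x $ j < 1" for j
      using corner_bounds[of n k j] by (meson le_less_trans less_le_trans)
    ultimately show "x \<in> A"
      unfolding A_def cell_def open_cube_def by (auto simp: less_imp_le)
  qed
  have cbox: "A \<subseteq> cbox a b"
    by (auto simp: A_def cell_def mem_box_cart a_def b_def less_imp_le)
  have "cbox a b - box a b \<in> null_sets lebesgue"
    using negligible_frontier_interval[of a b] by (simp add: negligible_iff_null_sets)
  then have null: "A - box a b \<in> null_sets lebesgue"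
    by (rule null_sets_completion_subset[rotated]) (use cbox in auto)
  have A_eq: "A = box a b \<union> (A - box a b)" using box by blast
  have meas: "A - box a b \<in> sets lebesgue" using null by auto
  have boxm: "box a b \<in> sets lebesgue" by simp
  show "A \<in> sets lebesgue"
    using sets.Un[OF boxm meas] A_eq by simp
  have "measure lebesgue A = measure lebesgue (box a b)"
    using measure_Un_null_set[OF boxm null] A_eq by simp
  also have "\<dots> = (\<Prod>j\<in>UNIV. b $ j - a $ j)"
  proof -
    have "cbox a b \<noteq> {}" using lt by (simp add: interval_ne_empty_cart less_imp_le)
    then have "measure lebesgue (cbox a b) = (\<Prod>j\<in>UNIV. b $ j - a $ j)"
      by (simp add: content_cbox_cart)
    then show ?thesis by (simp add: measure_lborel_box_eq measure_lborel_cbox_eq)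
  qed
  also have "\<dots> = (1/2) ^ n"
    by (simp add: a_def b_def prod_side)
  finally show "measure lebesgue A = (1/2) ^ n" .
qed

lemma node_level_set:
  assumes "2 ^ n \<le> k" "k < 2 ^ Suc n" "x \<in> open_cube"
  shows "node n x = k \<longleftrightarrow> x \<in> cell n k"
  using node_eqI[OF assms(1,2)] mem_cell_node[OF assms(3), of n] by auto

lemma of_bool_node:
  assumes "2 ^ n \<le> k" "k < 2 ^ Suc n"
  shows "integrable (cube_measure :: (real ^ 'n::finite) measure) (\<lambda>x. of_bool (node n x = k) :: real)"
    and "(\<integral>x. of_bool (node n x = k) \<partial>(cube_measure :: (real ^ 'n::finite) measure)) = (1/2 :: real) ^ n"
proof -
  let ?A = "cell n k \<inter> (open_cube :: (real ^ 'n) set)"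
  have eq: "of_bool (node n x = k) = indicat_real ?A x" if "x \<in> space cube_measure" for x :: "real ^ 'n"
    using node_level_set[OF assms, of x] that by (auto simp: indicator_def)
  have "integrable cube_measure (indicat_real ?A)" "(\<integral>x. indicat_real ?A x \<partial>cube_measure) = (1/2) ^ n"
    using integral_indicator_cube[of ?A] cell_measure[of n k, where 'n = 'n] by auto
  moreover have "integrable cube_measure (\<lambda>x :: real ^ 'n. of_bool (node n x = k) :: real) \<longleftrightarrow> integrable cube_measure (indicat_real ?A)"
    by (rule Bochner_Integration.integrable_cong[OF refl eq])
  moreover have "(\<integral>x. of_bool (node n x = k) \<partial>(cube_measure :: (real ^ 'n) measure)) = (\<integral>x. indicat_real ?A x \<partial>cube_measure)"
    by (rule Bochner_Integration.integral_cong[OF refl eq])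
  ultimately show "integrable (cube_measure :: (real ^ 'n::finite) measure) (\<lambda>x. of_bool (node n x = k) :: real)"
    and "(\<integral>x. of_bool (node n x = k) \<partial>(cube_measure :: (real ^ 'n::finite) measure)) = (1/2 :: real) ^ n"
    by (simp_all only:)
qed

lemma square_int_of_bool_node:
  assumes "2 ^ n \<le> k" "k < 2 ^ Suc n"
  shows "square_int (\<lambda>x :: real ^ 'n::finite. of_bool (node n x = k))"
  using of_bool_node(1)[OF assms, where 'n = 'n]
  by (intro square_int_bounded[where K = 1]) auto

section \<open>The Haar system\<close>

text \<open>
  The level of the heap index \<open>k\<close> is \<open>floor_log k\<close>. The factor normalises in \<open>L\<^sup>2\<close>, as a cell of level \<open>n\<close> has measure
  \<open>2 powr (- n)\<close>.
\<close>

definition haar :: "nat \<Rightarrow> real ^ 'n::finite \<Rightarrow> real" where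
  "haar k x = sqrt (2 ^ floor_log k) *
    (of_bool (node (Suc (floor_log k)) x = 2 * k + 1) - of_bool (node (Suc (floor_log k)) x = 2 * k))"

lemma floor_log_range:
  assumes "0 < k"
  shows "2 ^ floor_log k \<le> k" "k < 2 ^ Suc (floor_log k)"
    "2 ^ Suc (floor_log k) \<le> 2 * k" "2 * k < 2 ^ Suc (Suc (floor_log k))"
    "2 ^ Suc (floor_log k) \<le> 2 * k + 1" "2 * k + 1 < 2 ^ Suc (Suc (floor_log k))"
  using floor_log_exp2_le[OF assms] floor_log_exp2_gt[of k] by auto

lemma haar_support:
  assumes "haar k x \<noteq> 0"
  shows "node (floor_log k) x = k"
proof -
  have "node (Suc (floor_log k)) x = 2 * k + 1 \<or> node (Suc (floor_log k)) x = 2 * k"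
    using assms by (auto simp: haar_def split: if_splits)
  then have "node (Suc (floor_log k)) x div 2 = k" by auto
  then show ?thesis by (simp only: node_Suc_div_2)
qed

lemma square_int_haar:
  assumes "0 < k"
  shows "square_int (haar k :: real ^ 'n::finite \<Rightarrow> real)"
  unfolding haar_def
  by (intro square_int_cmult square_int_diff square_int_of_bool_node) (use floor_log_range[OF assms] in simp_all)

lemma haar_L20:
  assumes "0 < k"
  shows "(haar k :: real ^ 'n::finite \<Rightarrow> real) \<in> L20"
proof -
  let ?n = "Suc (floor_log k)"
  note 1 = of_bool_node[OF floor_log_range(5,6)[OF assms], where 'n = 'n]
  note 2 = of_bool_node[OF floor_log_range(3,4)[OF assms], where 'n = 'n]
  have "(\<integral>x. haar k x \<partial>(cube_measure :: (real ^ 'n) measure)) = 0"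
    unfolding haar_def using 1 2 by simp
  then show ?thesis
    using square_int_haar[OF assms] by (simp add: L20_iff)
qed

lemma abs_haar:
  "\<bar>haar k x\<bar> = sqrt (2 ^ floor_log k) *
    (of_bool (node (Suc (floor_log k)) x = 2 * k + 1) + of_bool (node (Suc (floor_log k)) x = 2 * k))"
  by (simp add: haar_def abs_mult)

lemma haar_L1_norm:
  assumes "0 < k"
  shows "(\<integral>x. \<bar>haar k x\<bar> \<partial>(cube_measure :: (real ^ 'n::finite) measure)) = sqrt (2 ^ floor_log k) * (1/2) ^ floor_log k"
proof -
  note 1 = of_bool_node[OF floor_log_range(5,6)[OF assms], where 'n = 'n]
  note 2 = of_bool_node[OF floor_log_range(3,4)[OF assms], where 'n = 'n]
  show ?thesis
    unfolding abs_haar using 1 2 by simp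
qed

lemma haar_normalized:
  assumes "0 < k"
  shows "l2_inner (haar k :: real ^ 'n::finite \<Rightarrow> real) (haar k) = 1"
proof -
  have "haar k x * haar k x = sqrt (2 ^ floor_log k) * \<bar>haar k x\<bar>" for x :: "real ^ 'n"
    unfolding abs_haar by (auto simp: haar_def)
  then have "l2_inner (haar k :: real ^ 'n \<Rightarrow> real) (haar k)
      = sqrt (2 ^ floor_log k) * (sqrt (2 ^ floor_log k) * (1/2) ^ floor_log k)"
    using haar_L1_norm[OF assms, where 'n = 'n] by (simp add: l2_inner_def)
  also have "\<dots> = 2 ^ floor_log k * (1/2) ^ floor_log k"
    by (simp flip: mult.assoc)
  also have "\<dots> = 1"
    by (simp flip: power_mult_distrib)
  finally show ?thesis .
qed

text \<open>
  A Haar function is constant on every cell of a finer level, and each Haar function integrates to zero over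
  the cell that carries it.
\<close>

lemma haar_orthogonal_finer:
  assumes "0 < j" "0 < k" "j \<noteq> k" "floor_log j \<le> floor_log k"
  shows "l2_inner (haar j :: real ^ 'n::finite \<Rightarrow> real) (haar k) = 0"
proof (cases "floor_log j = floor_log k")
  case True
  then have "haar j x * haar k x = 0" for x :: "real ^ 'n"
    using haar_support[of j x] haar_support[of k x] assms(3) by auto
  then show ?thesis by (simp only: l2_inner_def) simp
next
  case False
  define q where "q = k div 2 ^ (floor_log k - Suc (floor_log j))"
  define H :: real where "H = sqrt (2 ^ floor_log j) * (of_bool (q = 2 * j + 1) - of_bool (q = 2 * j))"
  have "haar j x * haar k x = H * haar k x" for x :: "real ^ 'n"
  proof (cases "haar k x = 0")
    case False
    then have "node (floor_log k) x = k" by (rule haar_support)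
    moreover have "floor_log k = Suc (floor_log j) + (floor_log k - Suc (floor_log j))"
      using assms(4) \<open>floor_log j \<noteq> floor_log k\<close> by simp
    ultimately have "node (Suc (floor_log j)) x = q"
      unfolding q_def using node_ancestor[of "Suc (floor_log j)" x "floor_log k - Suc (floor_log j)"] by simp
    then show ?thesis by (simp add: haar_def H_def)
  qed simp
  moreover have "(\<integral>x. haar k x \<partial>(cube_measure :: (real ^ 'n) measure)) = 0"
    using haar_L20[OF assms(2), where 'n = 'n] by (simp add: L20_iff)
  ultimately show ?thesis
    by (simp only: l2_inner_def integral_mult_right_zero mult_zero_right)
qed

lemma haar_orthonormal:
  assumes "0 < j" "0 < k"
  shows "l2_inner (haar j :: real ^ 'n::finite \<Rightarrow> real) (haar k) = (if j = k then 1 else 0)"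
proof (cases "j = k")
  case False
  show ?thesis
  proof (cases "floor_log j \<le> floor_log k")
    case True
    with False show ?thesis using haar_orthogonal_finer[OF assms] by simp
  next
    case 2: False
    with False show ?thesis
      using haar_orthogonal_finer[OF assms(2,1)] by (simp add: l2_inner_commute[of "haar j"])
  qed
qed (use haar_normalized assms in auto)

lemma half_power_eq_powr: "(1/2) ^ n = (2 powr (- real n) :: real)"
  by (simp add: powr_minus_divide powr_realpow power_one_over)

text \<open>
  A Haar function of level \<open>n\<close> has \<open>L\<^sup>1\<close> norm \<open>2 powr (- n / 2)\<close> and lives on a box of diameter of order
  \<open>2 powr (- n / d)\<close>; the index is comparable to \<open>2 ^ n\<close>. Of the constant \<open>8\<close>, a factor \<open>2\<close> pays for rounding
  \<open>n / d\<close> down and a factor \<open>4\<close> for replacing \<open>2 ^ n\<close> by \<open>k / 2\<close>.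
\<close>

lemma KR_norm_haar_le:
  assumes "0 < k"
  shows "KR_norm (haar k :: real ^ 'n::finite \<Rightarrow> real)
    \<le> 8 * real CARD('n) * real k powr (- (1 / real CARD('n) + 1/2))"
proof -
  let ?d = "CARD('n)"
  let ?n = "floor_log k"
  let ?s = "1 / real ?d + 1/2"
  have d: "1 \<le> real ?d" by (simp add: Suc_leI)
  have "KR_norm (haar k :: real ^ 'n \<Rightarrow> real)
      \<le> real ?d * (1/2) ^ (?n div ?d) * (\<integral>x. \<bar>haar k x\<bar> \<partial>(cube_measure :: (real ^ 'n) measure))"
  proof (rule KR_norm_le)
    show "(haar k :: real ^ 'n \<Rightarrow> real) \<in> L20" using assms by (rule haar_L20)
    fix x y :: "real ^ 'n"
    assume "x \<in> open_cube" "y \<in> open_cube" "haar k x \<noteq> 0" "haar k y \<noteq> 0"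
    then have "x \<in> cell ?n k" "y \<in> cell ?n k"
      using mem_cell_node[of x ?n] mem_cell_node[of y ?n] haar_support[of k x] haar_support[of k y] by auto
    then show "dist x y \<le> real ?d * (1/2) ^ (?n div ?d)"
      by (rule dist_cell_le)
  qed
  also have "\<dots> = real ?d * ((1/2) ^ (?n div ?d) * (sqrt (2 ^ ?n) * (1/2) ^ ?n))"
    by (simp add: haar_L1_norm[OF assms])
  also have "sqrt (2 ^ ?n) * (1/2) ^ ?n = 2 powr (- real ?n / 2)"
  proof -
    have "sqrt (2 ^ ?n) = 2 powr (real ?n / 2)"
      using powr_powr[of 2 "real ?n" "1/2"] by (simp add: powr_half_sqrt powr_realpow)
    then show ?thesis
      by (simp add: half_power_eq_powr powr_add[symmetric])
  qed
  also have "real ?d * ((1/2) ^ (?n div ?d) * 2 powr (- real ?n / 2))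
      \<le> real ?d * (2 powr (1 - real ?n / real ?d) * 2 powr (- real ?n / 2))"
  proof -
    have "?n < ?d + ?n div ?d * ?d"
      by (rule dividend_less_div_times) simp
    then have "real ?n < real (?d + ?n div ?d * ?d)"
      by (simp only: of_nat_less_iff)
    also have "\<dots> = (real (?n div ?d) + 1) * real ?d"
      by (simp add: algebra_simps)
    finally have "real ?n / real ?d < real (?n div ?d) + 1"
      by (subst pos_divide_less_eq) simp_all
    then have "2 powr (- real (?n div ?d)) \<le> (2 powr (1 - real ?n / real ?d) :: real)"
      by (intro powr_mono) auto
    then have "(1/2) ^ (?n div ?d) \<le> (2 powr (1 - real ?n / real ?d) :: real)"
      by (simp only: half_power_eq_powr)
    then show ?thesis
      by (intro mult_left_mono mult_right_mono) auto
  qed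
  also have "real ?d * (2 powr (1 - real ?n / real ?d) * 2 powr (- real ?n / 2))
      = real ?d * (2 * (2 ^ ?n) powr (- ?s))"
  proof -
    have "(2 ^ ?n :: real) powr (- ?s) = 2 powr (real ?n * (- ?s))"
      by (simp only: powr_realpow[symmetric, of 2 ?n] powr_powr)
    also have "2 * \<dots> = 2 powr (1 + real ?n * (- ?s))"
      by (simp only: powr_add) simp
    also have "1 + real ?n * (- ?s) = (1 - real ?n / real ?d) + (- real ?n / 2)"
      by (simp add: algebra_simps)
    finally show ?thesis by (simp only: powr_add)
  qed
  also have "\<dots> \<le> real ?d * (2 * (4 * real k powr (- ?s)))"
  proof -
    have "real k < real (2 ^ Suc ?n)"
      using floor_log_range(2)[OF assms] by (simp only: of_nat_less_iff)
    then have "(2 ^ ?n :: real) \<ge> real k / 2"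
      by simp
    moreover have s: "- ?s \<le> 0" "?s \<le> 2"
    proof -
      have "0 \<le> 1 / real ?d" "1 / real ?d \<le> 1" using d by simp_all
      then show "- ?s \<le> 0" "?s \<le> 2" by linarith+
    qed
    ultimately have "(2 ^ ?n :: real) powr (- ?s) \<le> (real k / 2) powr (- ?s)"
      using assms s(1) by (intro powr_mono2') (auto simp del: neg_le_0_iff_le)
    also have "\<dots> = real k powr (- ?s) * 2 powr ?s"
    proof -
      have "(real k / 2) powr (- t) = real k powr (- t) * 2 powr t" for t
        by (simp add: powr_divide powr_minus_divide)
      then show ?thesis .
    qed
    also have "\<dots> \<le> real k powr (- ?s) * 2 powr 2"
      using s by (intro mult_left_mono powr_mono) auto
    finally show ?thesis by simp
  qed
  finally show ?thesis by (simp add: mult_ac)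
qed

section \<open>Completeness of the Haar system\<close>

text \<open>
  Constants are included because the indicator of the whole cube, which is the root of the tree, has to be
  available; for functions of mean zero the constant drops out at the end.
\<close>

definition haar_span :: "(real ^ 'n::finite \<Rightarrow> real) set" where
  "haar_span = {f. \<exists>a N c. \<forall>x. f x = a + (\<Sum>i<N. c i * haar (Suc i) x)}"

lemma haar_span_const: "(\<lambda>x. a) \<in> haar_span"
  unfolding haar_span_def by (intro CollectI exI[of _ a] exI[of _ 0]) simp

lemma haar_span_cmult:
  assumes "f \<in> haar_span"
  shows "(\<lambda>x. b * f x) \<in> haar_span"
proof -
  obtain a N c where f: "\<And>x. f x = a + (\<Sum>i<N. c i * haar (Suc i) x)"
    using assms by (auto simp: haar_span_def)
  have "b * f x = b * a + (\<Sum>i<N. (b * c i) * haar (Suc i) x)" for x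
    by (simp add: f distrib_left sum_distrib_left mult.assoc)
  then show ?thesis unfolding haar_span_def mem_Collect_eq by (intro exI allI)
qed

lemma zero_padded_sum:
  fixes c h :: "nat \<Rightarrow> real"
  shows "(\<Sum>i<N. c i * h i) = (\<Sum>i<max N M. (if i < N then c i else 0) * h i)"
  by (rule sum.mono_neutral_cong_left) auto

lemma haar_span_add:
  assumes "f \<in> haar_span" "g \<in> haar_span"
  shows "(\<lambda>x. f x + g x) \<in> haar_span"
proof -
  obtain a N c where f: "\<And>x. f x = a + (\<Sum>i<N. c i * haar (Suc i) x)"
    using assms(1) by (auto simp: haar_span_def)
  obtain b M e where g: "\<And>x. g x = b + (\<Sum>i<M. e i * haar (Suc i) x)"
    using assms(2) by (auto simp: haar_span_def)
  have "f x + g x = (a + b) + (\<Sum>i<max N M. ((if i < N then c i else 0) + (if i < M then e i else 0)) * haar (Suc i) x)" for x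
    using zero_padded_sum[of c "\<lambda>i. haar (Suc i) x" N M] zero_padded_sum[of e "\<lambda>i. haar (Suc i) x" M N]
    by (simp only: f g distrib_right sum.distrib max.commute[of M N])
  then show ?thesis unfolding haar_span_def mem_Collect_eq by (intro exI allI)
qed

lemma haar_span_sum:
  "(\<And>i. i \<in> S \<Longrightarrow> f i \<in> haar_span) \<Longrightarrow> (\<lambda>x. \<Sum>i\<in>S. f i x) \<in> haar_span"
  by (induction S rule: infinite_finite_induct) (auto intro: haar_span_const haar_span_add)

lemma haar_mem_span:
  assumes "0 < k"
  shows "haar k \<in> haar_span"
proof -
  have "haar k x = 0 + (\<Sum>i<k. (if i = k - 1 then 1 else 0) * haar (Suc i) x)" for x :: "real ^ 'n"
  proof -
    have "(\<Sum>i<k. (if i = k - 1 then 1 else 0) * haar (Suc i) x) = (\<Sum>i<k. if i = k - 1 then haar (Suc i) x else 0)"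
      by (intro sum.cong) auto
    with assms show ?thesis by simp
  qed
  then show ?thesis unfolding haar_span_def mem_Collect_eq by (intro exI allI)
qed

text \<open>The indicator of either half of a cell is a combination of the indicator of the cell and its Haar function.\<close>

lemma of_bool_node_mem_span:
  assumes "2 ^ n \<le> k" "k < 2 ^ Suc n"
  shows "(\<lambda>x :: real ^ 'n::finite. of_bool (node n x = k)) \<in> haar_span"
  using assms
proof (induction n arbitrary: k)
  case 0
  then have "k = 1" by simp
  then show ?case by (simp add: haar_span_const)
next
  case (Suc n)
  define p where "p = k div 2"
  have p: "2 ^ n \<le> p" "p < 2 ^ Suc n" using Suc.prems by (auto simp: p_def)
  have p0: "0 < p" using p(1) by (meson less_le_trans zero_less_numeral zero_less_power)
  have fl: "floor_log p = n" using p by (intro floor_log_eqI) (auto simp: p0)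
  define r :: real where "r = (if odd k then 1 else - 1) / (2 * sqrt (2 ^ n))"
  have "of_bool (node (Suc n) x = k) = 1/2 * of_bool (node n x = p) + r * haar p x" for x :: "real ^ 'n"
  proof -
    have np: "node n x = p \<longleftrightarrow> node (Suc n) x = 2 * p \<or> node (Suc n) x = 2 * p + 1"
      using node_Suc_div_2[of n x] by presburger
    have k: "k = (if odd k then 2 * p + 1 else 2 * p)" by (simp add: p_def)
    have "r * sqrt (2 ^ n) = (if odd k then 1/2 else - 1/2)" by (simp add: r_def)
    then have "r * haar p x = (if odd k then 1/2 else - 1/2) *
        (of_bool (node (Suc n) x = 2 * p + 1) - of_bool (node (Suc n) x = 2 * p))"
      unfolding haar_def fl by (simp only: mult.assoc[symmetric])
    with np k show ?thesis
      by (cases "odd k"; cases "node (Suc n) x = 2 * p"; cases "node (Suc n) x = 2 * p + 1") (simp_all del: node.simps)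
  qed
  then have "(\<lambda>x :: real ^ 'n. of_bool (node (Suc n) x = k)) = (\<lambda>x. 1/2 * of_bool (node n x = p) + r * haar p x)"
    by (rule ext)
  moreover have "(\<lambda>x :: real ^ 'n. 1/2 * of_bool (node n x = p) + r * haar p x) \<in> haar_span"
    using Suc.IH[OF p] haar_mem_span[OF p0] by (intro haar_span_add haar_span_cmult)
  ultimately show ?case by (simp only:)
qed

lemma step_function_eq_sum:
  fixes g :: "nat \<Rightarrow> real"
  shows "g (node n x) = (\<Sum>k\<in>{2 ^ n..<2 ^ Suc n}. g k * of_bool (node n x = k))"
proof -
  have "(\<Sum>k\<in>{2 ^ n..<2 ^ Suc n}. g k * of_bool (node n x = k))
      = (\<Sum>k\<in>{2 ^ n..<2 ^ Suc n}. if k = node n x then g k else 0)"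
    by (intro sum.cong) auto
  then show ?thesis using node_range[of n x] by simp
qed

lemma step_function_mem_span: "(\<lambda>x. g (node n x)) \<in> haar_span"
  unfolding step_function_eq_sum[of g n]
  by (intro haar_span_sum haar_span_cmult of_bool_node_mem_span) auto

lemma square_int_step_function: "square_int (\<lambda>x. g (node n x))"
  unfolding step_function_eq_sum[of g n]
  by (intro square_int_sum square_int_cmult square_int_of_bool_node) auto

text \<open>Dominated convergence in \<open>L\<^sup>2\<close>, which serves all three approximation steps.\<close>

lemma l2_norm_diff_tendsto_0:
  fixes f :: "real ^ 'n::finite \<Rightarrow> real" and s :: "nat \<Rightarrow> real ^ 'n \<Rightarrow> real"
  assumes f: "square_int f" and s: "\<And>i. square_int (s i)"
    and w: "integrable cube_measure w"
    and lim: "AE x in cube_measure. (\<lambda>i. s i x) \<longlonglongrightarrow> f x"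
    and dom: "\<And>i x. x \<in> open_cube \<Longrightarrow> (f x - s i x)\<^sup>2 \<le> w x"
  shows "(\<lambda>i. l2_norm (\<lambda>x. f x - s i x)) \<longlonglongrightarrow> 0"
proof -
  have [measurable]: "f \<in> borel_measurable cube_measure" "\<And>i. s i \<in> borel_measurable cube_measure"
    using f s by (auto intro: square_int_measurable)
  have "(\<lambda>i. \<integral>x. (f x - s i x)\<^sup>2 \<partial>cube_measure) \<longlonglongrightarrow> (\<integral>x. 0 \<partial>(cube_measure :: (real ^ 'n) measure))"
  proof (rule integral_dominated_convergence[OF _ _ w])
    show "AE x in cube_measure. (\<lambda>i. (f x - s i x)\<^sup>2) \<longlonglongrightarrow> 0"
      using lim
    proof eventually_elim
      case (elim x)
      then have "(\<lambda>i. (f x - s i x)\<^sup>2) \<longlonglongrightarrow> (f x - f x)\<^sup>2" by (intro tendsto_intros)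
      then show ?case by simp
    qed
    show "AE x in cube_measure. norm ((f x - s i x)\<^sup>2) \<le> w x" for i
      using dom by (intro AE_I2) simp
  qed measurable
  then have "(\<lambda>i. sqrt (\<integral>x. (f x - s i x)\<^sup>2 \<partial>cube_measure)) \<longlonglongrightarrow> sqrt 0"
    by (intro tendsto_real_sqrt) simp
  then show ?thesis by (simp add: l2_norm_def l2_inner_def power2_eq_square)
qed

lemma square_diff_bounded_le:
  fixes a b K :: real
  assumes "\<bar>a\<bar> \<le> K" "\<bar>b\<bar> \<le> K"
  shows "(a - b)\<^sup>2 \<le> (2 * K)\<^sup>2"
proof -
  have "\<bar>a - b\<bar> \<le> 2 * K" using assms by linarith
  then show ?thesis by (metis abs_ge_zero power2_abs power_mono)
qed

lemma bounded_approx: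
  fixes f :: "real ^ 'n::finite \<Rightarrow> real"
  assumes f: "square_int f" and \<epsilon>: "0 < \<epsilon>"
  obtains K g where "g \<in> borel_measurable cube_measure" "\<And>x. \<bar>g x\<bar> \<le> K"
    "l2_norm (\<lambda>x. f x - g x) < \<epsilon>"
proof -
  define s where "s i x = max (- real i) (min (real i) (f x))" for i :: nat and x
  have [measurable]: "f \<in> borel_measurable cube_measure" using f by (rule square_int_measurable)
  have smeas: "s i \<in> borel_measurable cube_measure" for i unfolding s_def by measurable
  have sb: "\<bar>s i x\<bar> \<le> real i" for i x by (auto simp: s_def)
  have "(\<lambda>i. l2_norm (\<lambda>x. f x - s i x)) \<longlonglongrightarrow> 0"
  proof (rule l2_norm_diff_tendsto_0[OF f])
    show "square_int (s i)" for i using smeas sb by (rule square_int_bounded)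
    show "integrable cube_measure (\<lambda>x. (f x)\<^sup>2)" using f by (simp add: square_int_def)
    show "(f x - s i x)\<^sup>2 \<le> (f x)\<^sup>2" for i x
      by (rule abs_le_square_iff[THEN iffD1]) (auto simp: s_def max_def min_def abs_if)
    have "(\<lambda>i. s i x) \<longlonglongrightarrow> f x" for x
    proof (rule tendsto_eventually)
      obtain N where "\<bar>f x\<bar> \<le> real N" using real_arch_simple by blast
      then show "\<forall>\<^sub>F i in sequentially. s i x = f x"
        unfolding eventually_sequentially by (intro exI[of _ N]) (auto simp: s_def max_def min_def)
    qed
    then show "AE x in cube_measure. (\<lambda>i. s i x) \<longlonglongrightarrow> f x" by simp
  qed
  from eventually_happens[OF order_tendstoD(2)[OF this \<epsilon>]]
  obtain i where "l2_norm (\<lambda>x. f x - s i x) < \<epsilon>"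
    by auto
  with smeas sb show thesis by (intro that[of "s i" "real i"]) auto
qed

text \<open>
  A measurable function is almost everywhere a limit of continuous functions; cutting these off at the height \<open>K\<close>
  preserves continuity and the limit and makes the convergence dominated.
\<close>

lemma continuous_approx:
  fixes f :: "real ^ 'n::finite \<Rightarrow> real"
  assumes f: "f \<in> borel_measurable cube_measure" and K: "\<And>x. \<bar>f x\<bar> \<le> K" and \<epsilon>: "0 < \<epsilon>"
  obtains g where "continuous_on UNIV g" "\<And>x. \<bar>g x\<bar> \<le> K" "l2_norm (\<lambda>x. f x - g x) < \<epsilon>"
proof -
  have "f measurable_on open_cube"
    using f by (simp add: measurable_on_iff_borel_measurable)
  then obtain N h where N: "negligible N" and h: "\<And>i::nat. continuous_on UNIV (h i)"
    and lim: "\<And>x. x \<notin> N \<Longrightarrow> (\<lambda>i. h i x) \<longlonglongrightarrow> (if x \<in> open_cube then f x else 0)"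
    unfolding measurable_on_def by blast
  define s where "s i x = max (- K) (min K (h i x))" for i x
  have K0: "0 \<le> K" using K[of 0] by linarith
  have sb: "\<bar>s i x\<bar> \<le> K" for i x using K0 by (auto simp: s_def)
  have scont: "continuous_on UNIV (s i)" for i
    unfolding s_def by (intro continuous_intros h)
  have smeas: "s i \<in> borel_measurable cube_measure" for i
    by (rule continuous_imp_measurable_on_sets_lebesgue[OF continuous_on_subset[OF scont]]) auto
  have "(\<lambda>i. l2_norm (\<lambda>x. f x - s i x)) \<longlonglongrightarrow> 0"
  proof (rule l2_norm_diff_tendsto_0[where w = "\<lambda>x. (2 * K)\<^sup>2"])
    show "square_int f" using f K by (rule square_int_bounded)
    show "square_int (s i)" for i using smeas sb by (rule square_int_bounded)
    show "integrable cube_measure (\<lambda>x :: real ^ 'n. (2 * K)\<^sup>2)"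
      by (rule integrable_square_int[OF square_int_const])
    show "(f x - s i x)\<^sup>2 \<le> (2 * K)\<^sup>2" for i x
      using K sb by (rule square_diff_bounded_le)
    have conv: "(\<lambda>i. s i x) \<longlonglongrightarrow> f x" if "x \<in> open_cube" "x \<notin> N" for x
    proof -
      have "(\<lambda>i. s i x) \<longlonglongrightarrow> max (- K) (min K (f x))"
        unfolding s_def using lim[OF that(2)] that(1) by (intro tendsto_intros) simp
      moreover have "max (- K) (min K (f x)) = f x" using K[of x] by (auto simp: max_def min_def)
      ultimately show ?thesis by simp
    qed
    have "AE x in lebesgue. x \<notin> N"
      using N by (intro AE_not_in) (simp add: negligible_iff_null_sets)
    then have "AE x in lebesgue. x \<in> open_cube \<longrightarrow> (\<lambda>i. s i x) \<longlonglongrightarrow> f x"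
      by eventually_elim (use conv in auto)
    then show "AE x in cube_measure. (\<lambda>i. s i x) \<longlonglongrightarrow> f x"
      by (subst AE_restrict_space_iff) auto
  qed
  from eventually_happens[OF order_tendstoD(2)[OF this \<epsilon>]]
  obtain i where "l2_norm (\<lambda>x. f x - s i x) < \<epsilon>"
    by auto
  with scont sb show thesis by (intro that[of "s i"]) auto
qed

lemma corner_node_tendsto:
  fixes x :: "real ^ 'n::finite"
  assumes "x \<in> open_cube"
  shows "(\<lambda>n. corner n (node n x)) \<longlonglongrightarrow> x"
proof -
  let ?d = "CARD('n)"
  have le: "dist (corner n (node n x)) x \<le> real ?d * (1/2) ^ (n div ?d)" for n
    by (rule dist_cell_le[OF corner_mem_cell mem_cell_node[OF assms]])
  have "filterlim (\<lambda>n. n div ?d) at_top sequentially"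
    unfolding filterlim_at_top
  proof
    fix Z :: nat
    show "\<forall>\<^sub>F n in sequentially. Z \<le> n div ?d"
      using eventually_ge_at_top[of "Z * ?d"]
      by eventually_elim (simp add: less_eq_div_iff_mult_less_eq)
  qed
  then have "(\<lambda>n. (1/2::real) ^ (n div ?d)) \<longlonglongrightarrow> 0"
    by (rule filterlim_compose[rotated]) (intro LIMSEQ_power_zero, simp)
  then have "(\<lambda>n. real ?d * (1/2) ^ (n div ?d)) \<longlonglongrightarrow> 0"
    using tendsto_mult_right_zero by blast
  then have "(\<lambda>n. dist (corner n (node n x)) x) \<longlonglongrightarrow> 0"
    by (rule Lim_null_comparison[rotated]) (use le in simp)
  then show ?thesis by (subst tendsto_dist_iff)
qed

text \<open>
  Sampling \<open>g\<close> at the corner of the cell containing \<open>x\<close> gives a step function that converges pointwise, since the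
  cells shrink to \<open>x\<close>.
\<close>

lemma step_approx:
  fixes g :: "real ^ 'n::finite \<Rightarrow> real"
  assumes g: "continuous_on UNIV g" and K: "\<And>x. \<bar>g x\<bar> \<le> K" and \<epsilon>: "0 < \<epsilon>"
  obtains s where "s \<in> haar_span" "square_int s" "l2_norm (\<lambda>x. g x - s x) < \<epsilon>"
proof -
  define s where "s n x = g (corner n (node n x))" for n and x :: "real ^ 'n"
  have "(\<lambda>n. l2_norm (\<lambda>x. g x - s n x)) \<longlonglongrightarrow> 0"
  proof (rule l2_norm_diff_tendsto_0[where w = "\<lambda>x. (2 * K)\<^sup>2"])
    have "g \<in> borel_measurable cube_measure"
      by (rule continuous_imp_measurable_on_sets_lebesgue[OF continuous_on_subset[OF g]]) auto
    then show "square_int g" using K by (rule square_int_bounded)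
    show "square_int (s n)" for n
      unfolding s_def by (rule square_int_step_function[of "\<lambda>k. g (corner n k)"])
    show "integrable cube_measure (\<lambda>x :: real ^ 'n. (2 * K)\<^sup>2)"
      by (rule integrable_square_int[OF square_int_const])
    show "(g x - s n x)\<^sup>2 \<le> (2 * K)\<^sup>2" for n x
      unfolding s_def using K by (intro square_diff_bounded_le)
    have "(\<lambda>n. s n x) \<longlonglongrightarrow> g x" if "x \<in> open_cube" for x
      unfolding s_def using corner_node_tendsto[OF that] g
      by (intro continuous_on_tendsto_compose[of UNIV g]) auto
    then show "AE x in cube_measure. (\<lambda>n. s n x) \<longlonglongrightarrow> g x"
      by (intro AE_I2) simp
  qed
  from eventually_happens[OF order_tendstoD(2)[OF this \<epsilon>]]
  obtain n where "l2_norm (\<lambda>x. g x - s n x) < \<epsilon>"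
    by auto
  moreover have "s n \<in> haar_span" "square_int (s n)"
    unfolding s_def using step_function_mem_span[of "\<lambda>k. g (corner n k)"]
      square_int_step_function[of "\<lambda>k. g (corner n k)"] by auto
  ultimately show thesis by (intro that)
qed

text \<open>
  After truncation, smoothing and sampling, \<open>f\<close> is close to a constant plus a Haar sum. The constant is orthogonal
  to functions of mean zero, so leaving it out only improves the approximation.
\<close>

lemma haar_complete:
  fixes f :: "real ^ 'n::finite \<Rightarrow> real"
  assumes f: "f \<in> L20" and \<epsilon>: "0 < \<epsilon>"
  shows "\<exists>N c. l2_norm (\<lambda>x. f x - (\<Sum>k<N. c k * haar (Suc k) x)) < \<epsilon>"
proof -
  have fs: "square_int f" using f by (rule L20_square_int)
  have \<epsilon>3: "0 < \<epsilon> / 3" using \<epsilon> by simp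
  obtain K g where g: "g \<in> borel_measurable cube_measure" "\<And>x. \<bar>g x\<bar> \<le> K" "l2_norm (\<lambda>x. f x - g x) < \<epsilon> / 3"
    by (rule bounded_approx[OF fs \<epsilon>3]) blast
  obtain h where h: "continuous_on UNIV h" "\<And>x. \<bar>h x\<bar> \<le> K" "l2_norm (\<lambda>x. g x - h x) < \<epsilon> / 3"
    by (rule continuous_approx[OF g(1,2) \<epsilon>3]) blast
  obtain s where s: "s \<in> haar_span" "square_int s" "l2_norm (\<lambda>x. h x - s x) < \<epsilon> / 3"
    by (rule step_approx[OF h(1,2) \<epsilon>3])
  have gs: "square_int g" using g(1,2) by (rule square_int_bounded)
  have "h \<in> borel_measurable cube_measure"
    by (rule continuous_imp_measurable_on_sets_lebesgue[OF continuous_on_subset[OF h(1)]]) auto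
  then have hs: "square_int h" using h(2) by (rule square_int_bounded)
  have "l2_norm (\<lambda>x. (f x - g x) + ((g x - h x) + (h x - s x)))
      \<le> l2_norm (\<lambda>x. f x - g x) + l2_norm (\<lambda>x. (g x - h x) + (h x - s x))"
    by (intro l2_norm_triangle square_int_diff square_int_add fs gs hs s(2))
  also have "l2_norm (\<lambda>x. (g x - h x) + (h x - s x)) \<le> l2_norm (\<lambda>x. g x - h x) + l2_norm (\<lambda>x. h x - s x)"
    by (intro l2_norm_triangle square_int_diff gs hs s(2))
  finally have fs_close: "l2_norm (\<lambda>x. f x - s x) < \<epsilon>"
    using g(3) h(3) s(3) by simp
  obtain a N c where s_eq: "\<And>x. s x = a + (\<Sum>i<N. c i * haar (Suc i) x)"
    using s(1) by (auto simp: haar_span_def)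
  define q where "q x = f x - (\<Sum>i<N. c i * haar (Suc i) x)" for x
  have q: "q \<in> L20"
    unfolding q_def by (intro L20_diff f L20_sum L20_cmult haar_L20) simp
  have "l2_inner (\<lambda>x. q x - a) (\<lambda>x. q x - a) = l2_inner q q - 2 * l2_inner q (\<lambda>x. a) + l2_inner (\<lambda>x. a) (\<lambda>x :: real ^ 'n. a)"
    by (intro l2_inner_diff_self L20_square_int[OF q] square_int_const)
  also have "l2_inner q (\<lambda>x. a) = 0"
    using q by (simp add: l2_inner_def L20_iff)
  finally have "l2_inner q q \<le> l2_inner (\<lambda>x. q x - a) (\<lambda>x. q x - a)"
    using l2_inner_self_nonneg[of "\<lambda>x :: real ^ 'n. a"] by simp
  moreover have "(\<lambda>x. q x - a) = (\<lambda>x. f x - s x)"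
    by (simp add: q_def s_eq fun_eq_iff)
  ultimately have "l2_norm q \<le> l2_norm (\<lambda>x. f x - s x)"
    by (simp add: l2_norm_def)
  with fs_close have "l2_norm q < \<epsilon>" by simp
  then show ?thesis unfolding q_def by blast
qed

lemma haar_orthonormal_basis:
  "l2_orthonormal_basis (\<lambda>k. haar (Suc k) :: real ^ 'n::finite \<Rightarrow> real)"
  unfolding l2_orthonormal_basis_def
  using haar_L20[where 'n = 'n] haar_orthonormal[where 'n = 'n] haar_complete[where 'n = 'n] by simp

text \<open>The exponent \<open>1 / d + 1/2\<close> of the decay is \<open>1 / \<alpha>\<close>, so the terms are dominated by a multiple of
  \<open>k powr (- 1 - \<epsilon> / \<alpha>)\<close>.\<close>

lemma haar_KR_norm_summable:
  fixes \<alpha> \<epsilon> :: real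
  assumes alpha: "\<alpha> = 2 * real CARD('n::finite) / (real CARD('n) + 2)" and \<epsilon>: "0 < \<epsilon>"
  shows "(\<Sum>k. ennreal (KR_norm (haar (Suc k) :: real ^ 'n \<Rightarrow> real) powr (\<alpha> + \<epsilon>))) < \<infinity>"
proof -
  let ?d = "real CARD('n)"
  let ?s = "1 / ?d + 1/2"
  have d: "1 \<le> ?d" by (simp add: Suc_leI)
  have \<alpha>: "0 < \<alpha>" using d by (simp add: alpha)
  have "?s * \<alpha> = 1"
  proof -
    have "?s = (?d + 2) / (2 * ?d)" using d by (simp add: field_simps)
    with d show ?thesis by (simp add: alpha)
  qed
  then have "?s * (\<alpha> + \<epsilon>) = 1 + ?s * \<epsilon>"
    by (simp only: distrib_left)
  moreover have "0 < ?s * \<epsilon>"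
    using d \<epsilon> by (intro mult_pos_pos add_pos_pos) simp_all
  ultimately have exponent: "- ?s * (\<alpha> + \<epsilon>) < - 1"
    by (simp only: mult_minus_left)
  have summ: "summable (\<lambda>k. (8 * ?d) powr (\<alpha> + \<epsilon>) * real (Suc k) powr (- ?s * (\<alpha> + \<epsilon>)))"
    using exponent by (intro summable_mult) (simp only: summable_Suc_iff[of "\<lambda>k. real k powr (- ?s * (\<alpha> + \<epsilon>))"] summable_real_powr_iff)
  have le: "KR_norm (haar (Suc k) :: real ^ 'n \<Rightarrow> real) powr (\<alpha> + \<epsilon>)
      \<le> (8 * ?d) powr (\<alpha> + \<epsilon>) * real (Suc k) powr (- ?s * (\<alpha> + \<epsilon>))" for k
  proof -
    have "KR_norm (haar (Suc k) :: real ^ 'n \<Rightarrow> real) powr (\<alpha> + \<epsilon>) \<le> (8 * ?d * real (Suc k) powr (- ?s)) powr (\<alpha> + \<epsilon>)"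
      using KR_norm_haar_le[of "Suc k", where 'n = 'n] KR_norm_nonneg[OF haar_L20[of "Suc k", where 'n = 'n]] \<alpha> \<epsilon>
      by (intro powr_mono2) auto
    also have "\<dots> = (8 * ?d) powr (\<alpha> + \<epsilon>) * real (Suc k) powr (- ?s * (\<alpha> + \<epsilon>))"
      by (simp only: powr_mult powr_powr)
    finally show ?thesis .
  qed
  have "summable (\<lambda>k. KR_norm (haar (Suc k) :: real ^ 'n \<Rightarrow> real) powr (\<alpha> + \<epsilon>))"
    by (rule summable_comparison_test'[OF summ, of 0]) (use le in simp)
  then have "(\<Sum>k. ennreal (KR_norm (haar (Suc k) :: real ^ 'n \<Rightarrow> real) powr (\<alpha> + \<epsilon>)))
      = ennreal (\<Sum>k. KR_norm (haar (Suc k) :: real ^ 'n \<Rightarrow> real) powr (\<alpha> + \<epsilon>))"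
    by (intro suminf_ennreal2) auto
  then show ?thesis by simp
qed

section \<open>Critical exponent\<close>

theorem theorem6p1:
  fixes \<alpha> :: real
  assumes alpha: "\<alpha> = 2 * real CARD('n::finite) / (real CARD('n) + 2)"
  shows "(\<exists>u :: nat \<Rightarrow> real ^ 'n \<Rightarrow> real. l2_orthonormal_basis u \<and>
            (\<forall>\<epsilon>>0. (\<Sum>k. ennreal (KR_norm (u k) powr (\<alpha> + \<epsilon>))) < \<infinity>)) \<and>
         (\<forall>u :: nat \<Rightarrow> real ^ 'n \<Rightarrow> real. l2_frame u \<longrightarrow>
            (\<Sum>k. ennreal (KR_norm (u k) powr \<alpha>)) = \<infinity>) \<and>
         (\<forall>u :: nat \<Rightarrow> real ^ 'n \<Rightarrow> real. l2_riesz_basis u \<longrightarrow>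
            (\<Sum>k. ennreal (KR_norm (u k) powr \<alpha>)) = \<infinity>)"
proof (intro conjI allI impI)
  show "\<exists>u :: nat \<Rightarrow> real ^ 'n \<Rightarrow> real. l2_orthonormal_basis u \<and>
      (\<forall>\<epsilon>>0. (\<Sum>k. ennreal (KR_norm (u k) powr (\<alpha> + \<epsilon>))) < \<infinity>)"
    by (intro exI[of _ "\<lambda>k. haar (Suc k)"] conjI allI impI haar_orthonormal_basis haar_KR_norm_summable[OF alpha])
next
  fix u :: "nat \<Rightarrow> real ^ 'n \<Rightarrow> real"
  assume frame: "l2_frame u"
  then have u: "u k \<in> L20" for k
    unfolding l2_frame_def by blast
  show "(\<Sum>k. ennreal (KR_norm (u k) powr \<alpha>)) = \<infinity>"
  proof (rule frame_norm_bound[OF frame], goal_cases)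
    case (1 b B)
    then show ?case by (intro KR_norm_powr_diverges[OF alpha u 1(2) 1(1) 1(3)])
  qed
next
  fix u :: "nat \<Rightarrow> real ^ 'n \<Rightarrow> real"
  assume riesz: "l2_riesz_basis u"
  then have u: "u k \<in> L20" for k
    unfolding l2_riesz_basis_def by blast
  show "(\<Sum>k. ennreal (KR_norm (u k) powr \<alpha>)) = \<infinity>"
  proof (rule riesz_basis_lower_bound[OF riesz], goal_cases)
    case (1 b B)
    then show ?case by (intro KR_norm_powr_diverges[OF alpha u 1(2) 1(1) 1(3)])
  qed
qed

end
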